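(* In types $E_6^{(2)}$ and $F_4^{(1)}$, let $Y=(\dots,y_2,y_1,y_0)\in\mathcal Z(\lambda)$ be a proper Young wall and let $k\ge0$. If $$H(y_{k+1}\otimes y_k)+|y_{k+1}|_0-|y_k|_0\neq-1$$ (with $H$ replaced by $H'$ in type $F_4^{(1)}$), then columns $k+1$ and $k$ satisfy the local right block property: whenever $Y$ contains a block in column $k+1$, it contains the block occupying the same position in column $k$.
   Context: **Young column patterns.** $I=\{0,1,2,3,4\}$ is the set of colors. A pattern is an infinite vertical stack of colored blocks arranged in rows indexed by $\mathbb Z$ from bottom to top. It is invariant under the shift by four rows combined with the $180^\circ$ rotation around the vertical axis; this symmetry $\sigma$ sends a block with index $m$ to the block with the same letter and index $m+1$. "$x$ on $y$" means block $x$ rests on block $y$ (so $y$ must be present for there to be no empty space below $x$); $i$-block means a block of color $i$. *Type $E_6^{(2)}$*, for every $m\in\mathbb Z$: row $4m$: $c_m$ (color 3), $a_m$ (color 1); row $4m+1$: $b_m,b'_m$ (color 2); row $4m+2$: $a'_m$ (color 1), $c'_m$ (color 3); row $4m+3$: $z_m$ (color 0), $b''_m$ (color 2), $d_m$ (color 4). Support: $b_m$ on $c_m$; $b'_m$ on $c_m,a_m$; $a'_m$ on $b_m$; $c'_m$ on $b_m,b'_m$; $z_m$ on $a'_m$; $b''_m$ on $a'_m,c'_m$; $d_m$ on $c'_m$; $a_{m+1}$ on $z_m,b''_m$; $c_{m+1}$ on $b''_m,d_m$. *Type $F_4^{(1)}$*, for every $m\in\mathbb Z$: row $4m$: $c^1_m$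 (color 3), $d^1_m$ (color 4), $a^1_m$ (color 1); row $4m+1$: $c^2_m$ (color 3), $b^1_m$ (color 2); row $4m+2$: $b^2_m$ (color 2), $c^3_m$ (color 3); row $4m+3$ (a double-height row): $a^2_m$ (color 1), $c^4_m$ (color 3), $d^2_m$ (color 4), $z_m$ (color 0), $b^3_m$ (color 2). Support: $c^2_m$ on $c^1_m,d^1_m$; $b^1_m$ on $c^1_m,a^1_m$; $b^2_m$ on $c^2_m$; $c^3_m$ on $b^1_m$; $a^2_m$ on $b^2_m$; $c^4_m$ on $b^2_m,c^3_m$; $d^2_m$ on $c^3_m$; $z_m$ on $a^2_m$; $b^3_m$ on $a^2_m,c^4_m$; $c^1_{m+1}$ on $b^3_m,c^4_m,d^2_m$; $d^1_{m+1}$ on $c^4_m,d^2_m$; $a^1_{m+1}$ on $z_m,b^3_m$. **Young columns.** A pre-Young column is a nonempty set of blocks of the pattern whose height is bounded above and which contains, with any block, all blocks it rests on. A block of it is free if removing it leaves a pre-Young column. A pre-Young column is exceptional if its highest nonempty row contains precisely one free $2$-block and the column contains a free $1$-block (up to $\sigma$ the only one is: all blocks of index $\le0$ together with $a_1,c_1,b_1$ in type $E_6^{(2)}$, and with $c^1_1,d^1_1,a^1_1,c^2_1,b^2_1$ in type $F_4^{(1)}$). A Young column is a non-exceptional pre-Young column. Two Young columns are equivalent if they are related by vertical shift and $180^\circ$ rotation, i.e. by a power of $\sigma$. Let $C$ (resp. $C'$) be the set of equivalence classes in type $E_6^{(2)}$ (resp. $F_4^{(1)}$). Some classes have names. *Type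 $E_6^{(2)}$:* let $D$ be the set of all blocks of index $\le-1$ and $c_0,a_0,b_0,b'_0,a'_0,c'_0,b''_0$; $y_\emptyset$ is the class of $D\cup\{d_0,c_1,b_1,a'_1,z_1\}$, $y_{r_1}$ of $D\cup\{z_0,d_0,c_1,b_1,a'_1\}$, $y_{r_2}$ of $D\cup\{z_0,a_1,b'_1,d_0,c_1\}$. *Type $F_4^{(1)}$:* let $D$ be the set of all blocks of index $\le-1$ and all blocks of index $0$ except $z_0,d^2_0$; $y_\emptyset$ is the class of $D\cup\{d^2_0,c^1_1,d^1_1,c^2_1,b^2_1,a^2_1,z_1\}$, $y_{r_1}$ of $D\cup\{z_0,d^2_0,c^1_1,d^1_1,c^2_1,b^2_1,a^2_1\}$, $y_{r_2}$ of $D\cup\{z_0,a^1_1,b^1_1,d^2_0,c^1_1,d^1_1,c^2_1\}$, $y_{r_3}$ of $D\cup\{z_0,a^1_1,b^1_1,c^3_1,d^2_0,c^1_1,d^1_1\}$, $y_{r_4}$ of $D\cup\{z_0,a^1_1,b^1_1,c^3_1,d^2_1,d^2_0,c^1_1\}$. **Crystal operators on Young columns.** An $i$-block in a Young column $y$ is removable if removing it gives a Young column; an $i$-block of the pattern not in $y$ is addable if adding it gives a Young column. $\tilde f_i$ adds an addable $i$-block if one exists (the higher one if there are two), else gives $0$; moreover $\tilde f_i(y)=0$ if $y\in y_{r_j}$, $j\ne i$. $\tilde e_i$ removes a removable $i$-block if one exists (the lower one if there are two), else gives $0$; moreover $\tilde e_i(y)=0$ if $y\in y_{r_j}$, $j\neq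 i$. $\varphi_i(y)=\max\{n:\tilde f_i^ny\ne0\}$, $\varepsilon_i(y)=\max\{n:\tilde e_i^ny\neq0\}$. These descend to $C$ and $C'$, making them classical crystals isomorphic to level $1$ perfect crystals of $U_q(E_6^{(2)})$ and $U_q(F_4^{(1)})$. **Energy function.** On tensor products, $\tilde f_i(a\otimes b)=\tilde f_ia\otimes b$ if $\varphi_i(a)>\varepsilon_i(b)$ and $a\otimes\tilde f_ib$ if $\varphi_i(a)\le\varepsilon_i(b)$. $H:C\otimes C\to\mathbb Z$ (resp. $H':C'\otimes C'\to\mathbb Z$) is the unique function with value $0$ at $y_\emptyset\otimes y_\emptyset$ such that, whenever $\tilde f_i(a\otimes b)\neq0$, $H(\tilde f_i(a\otimes b))-H(a\otimes b)$ equals $0$ if $i\ne0$, $-1$ if $i=0$ and $\varphi_0(a)>\varepsilon_0(b)$, and $+1$ if $i=0$ and $\varphi_0(a)\le\varepsilon_0(b)$ (and likewise for $H'$). **Young walls.** $\lambda=\Lambda_0$. The Young wall pattern consists of copies of the Young column pattern, all at the same height and orientation, placed in columns $k=0,1,2,\dots$ from right to left; blocks in different columns occupy the same position if they are the same block of the Young column pattern. Fix a Young column $g\in y_\emptyset$ (the ground-state column); the ground-state wall has $g$ in every column. A Young wall $Y=(\dots,y_2,y_1,y_0)$ is a set of blocks in the Young wall pattern differing from the ground-state wall in finitely many blocks and such that each column $y_k$ is a Young column. $|y_k|_0$ is the number of $0$-blocks in $y_k\setminus g$ minus that in $g\setminus y_k$. A Young wall is proper if $H(y_{k+1}\otimes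 y_k)+|y_{k+1}|_0-|y_k|_0\le0$ for all $k\ge0$ (with $H'$ in place of $H$ in type $F_4^{(1)}$; classes of columns are inserted in $H,H'$). $\mathcal Z(\lambda)$ is the set of proper Young walls. *)

theory Defs
  imports Main
begin

section \<open>Young column patterns\<close>

text \<open>
  A block is a letter together with its index; a column is a set of blocks.  The block
  \<open>(l, m)\<close> lies in row \<open>4 * m + level l\<close>, where \<open>level l \<in> {0,1,2,3}\<close>, and
  \<open>rests_on P b\<close> is the set of all blocks on which \<open>b\<close> rests.  The field
  \<open>vacuum\<close> is the distinguished representative of the class \<open>y_\<emptyset>\<close>, and
  \<open>special j = Some y\<close> says that \<open>y\<close> is the distinguished representative of
  the class \<open>y_{r_j}\<close>.
\<close>

type_synonym 'l block = "'l \<times> int"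
type_synonym 'l column = "'l block set"

record 'l young_pattern =
  level :: "'l \<Rightarrow> int"
  letter_colour :: "'l \<Rightarrow> nat"
  rests_on :: "'l block \<Rightarrow> 'l block set"
  vacuum :: "'l column"
  special :: "nat \<rightharpoonup> 'l column"

definition colours :: "nat set" where
  "colours = {0, 1, 2, 3, 4}"

definition row :: "('l, 'm) young_pattern_scheme \<Rightarrow> 'l block \<Rightarrow> int" where
  "row P b = 4 * snd b + level P (fst b)"

definition colour :: "('l, 'm) young_pattern_scheme \<Rightarrow> 'l block \<Rightarrow> nat" where
  "colour P b = letter_colour P (fst b)"

subsection \<open>Type $E_6^{(2)}$\<close>

datatype e_letter = Ec | Ea | Eb | Eb' | Ea' | Ec' | Ez | Eb'' | Ed

fun e_level :: "e_letter \<Rightarrow> int" where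
  "e_level Ec = 0"
| "e_level Ea = 0"
| "e_level Eb = 1"
| "e_level Eb' = 1"
| "e_level Ea' = 2"
| "e_level Ec' = 2"
| "e_level Ez = 3"
| "e_level Eb'' = 3"
| "e_level Ed = 3"

fun e_colour :: "e_letter \<Rightarrow> nat" where
  "e_colour Ec = 3"
| "e_colour Ea = 1"
| "e_colour Eb = 2"
| "e_colour Eb' = 2"
| "e_colour Ea' = 1"
| "e_colour Ec' = 3"
| "e_colour Ez = 0"
| "e_colour Eb'' = 2"
| "e_colour Ed = 4"

fun e_rests_on :: "e_letter block \<Rightarrow> e_letter block set" where
  "e_rests_on (Eb, m) = {(Ec, m)}"
| "e_rests_on (Eb', m) = {(Ec, m), (Ea, m)}"
| "e_rests_on (Ea', m) = {(Eb, m)}"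
| "e_rests_on (Ec', m) = {(Eb, m), (Eb', m)}"
| "e_rests_on (Ez, m) = {(Ea', m)}"
| "e_rests_on (Eb'', m) = {(Ea', m), (Ec', m)}"
| "e_rests_on (Ed, m) = {(Ec', m)}"
| "e_rests_on (Ea, m) = {(Ez, m - 1), (Eb'', m - 1)}"
| "e_rests_on (Ec, m) = {(Eb'', m - 1), (Ed, m - 1)}"

definition e_base :: "e_letter column" where
  "e_base = {(l, m). m \<le> -1} \<union>
     {(Ec, 0), (Ea, 0), (Eb, 0), (Eb', 0), (Ea', 0), (Ec', 0), (Eb'', 0)}"

definition pattern_E6_2 :: "e_letter young_pattern" where
  "pattern_E6_2 =
     \<lparr> level = e_level,
       letter_colour = e_colour,
       rests_on = e_rests_on,
       vacuum = e_base \<union> {(Ed, 0), (Ec, 1), (Eb, 1), (Ea', 1), (Ez, 1)},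
       special =
         [1 \<mapsto> e_base \<union> {(Ez, 0), (Ed, 0), (Ec, 1), (Eb, 1), (Ea', 1)},
          2 \<mapsto> e_base \<union> {(Ez, 0), (Ea, 1), (Eb', 1), (Ed, 0), (Ec, 1)}] \<rparr>"

subsection \<open>Type $F_4^{(1)}$\<close>

datatype f_letter =
  Fc1 | Fd1 | Fa1 | Fc2 | Fb1 | Fb2 | Fc3 | Fa2 | Fc4 | Fd2 | Fz | Fb3

fun f_level :: "f_letter \<Rightarrow> int" where
  "f_level Fc1 = 0"
| "f_level Fd1 = 0"
| "f_level Fa1 = 0"
| "f_level Fc2 = 1"
| "f_level Fb1 = 1"
| "f_level Fb2 = 2"
| "f_level Fc3 = 2"
| "f_level Fa2 = 3"
| "f_level Fc4 = 3"
| "f_level Fd2 = 3"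
| "f_level Fz = 3"
| "f_level Fb3 = 3"

fun f_colour :: "f_letter \<Rightarrow> nat" where
  "f_colour Fc1 = 3"
| "f_colour Fd1 = 4"
| "f_colour Fa1 = 1"
| "f_colour Fc2 = 3"
| "f_colour Fb1 = 2"
| "f_colour Fb2 = 2"
| "f_colour Fc3 = 3"
| "f_colour Fa2 = 1"
| "f_colour Fc4 = 3"
| "f_colour Fd2 = 4"
| "f_colour Fz = 0"
| "f_colour Fb3 = 2"

text \<open>Row $4m+3$ has double height, so some of its blocks rest on other blocks of that row.\<close>

fun f_rests_on :: "f_letter block \<Rightarrow> f_letter block set" where
  "f_rests_on (Fc2, m) = {(Fc1, m), (Fd1, m)}"
| "f_rests_on (Fb1, m) = {(Fc1, m), (Fa1, m)}"
| "f_rests_on (Fb2, m) = {(Fc2, m)}"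
| "f_rests_on (Fc3, m) = {(Fb1, m)}"
| "f_rests_on (Fa2, m) = {(Fb2, m)}"
| "f_rests_on (Fc4, m) = {(Fb2, m), (Fc3, m)}"
| "f_rests_on (Fd2, m) = {(Fc3, m)}"
| "f_rests_on (Fz, m) = {(Fa2, m)}"
| "f_rests_on (Fb3, m) = {(Fa2, m), (Fc4, m)}"
| "f_rests_on (Fc1, m) = {(Fb3, m - 1), (Fc4, m - 1), (Fd2, m - 1)}"
| "f_rests_on (Fd1, m) = {(Fc4, m - 1), (Fd2, m - 1)}"
| "f_rests_on (Fa1, m) = {(Fz, m - 1), (Fb3, m - 1)}"

definition f_base :: "f_letter column" where
  "f_base = {(l, m). m \<le> -1} \<union> {(l, m). m = 0 \<and> l \<noteq> Fz \<and> l \<noteq> Fd2}"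

definition pattern_F4_1 :: "f_letter young_pattern" where
  "pattern_F4_1 =
     \<lparr> level = f_level,
       letter_colour = f_colour,
       rests_on = f_rests_on,
       vacuum = f_base \<union>
         {(Fd2, 0), (Fc1, 1), (Fd1, 1), (Fc2, 1), (Fb2, 1), (Fa2, 1), (Fz, 1)},
       special =
         [1 \<mapsto> f_base \<union>
            {(Fz, 0), (Fd2, 0), (Fc1, 1), (Fd1, 1), (Fc2, 1), (Fb2, 1), (Fa2, 1)},
          2 \<mapsto> f_base \<union>
            {(Fz, 0), (Fa1, 1), (Fb1, 1), (Fd2, 0), (Fc1, 1), (Fd1, 1), (Fc2, 1)},
          3 \<mapsto> f_base \<union>
            {(Fz, 0), (Fa1, 1), (Fb1, 1), (Fc3, 1), (Fd2, 0), (Fc1, 1), (Fd1, 1)},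
          4 \<mapsto> f_base \<union>
            {(Fz, 0), (Fa1, 1), (Fb1, 1), (Fc3, 1), (Fd2, 1), (Fd2, 0), (Fc1, 1)}] \<rparr>"

section \<open>Young columns\<close>

definition pre_young_column :: "('l, 'm) young_pattern_scheme \<Rightarrow> 'l column \<Rightarrow> bool" where
  "pre_young_column P y \<longleftrightarrow>
     y \<noteq> {} \<and> (\<exists>n. \<forall>b\<in>y. row P b \<le> n) \<and> (\<forall>b\<in>y. rests_on P b \<subseteq> y)"

definition free_block ::
    "('l, 'm) young_pattern_scheme \<Rightarrow> 'l column \<Rightarrow> 'l block \<Rightarrow> bool" where
  "free_block P y b \<longleftrightarrow> b \<in> y \<and> pre_young_column P (y - {b})"

definition exceptional :: "('l, 'm) young_pattern_scheme \<Rightarrow> 'l column \<Rightarrow> bool" where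
  "exceptional P y \<longleftrightarrow>
     pre_young_column P y \<and>
     (\<exists>!b. free_block P y b \<and> colour P b = 2 \<and> (\<forall>b'\<in>y. row P b' \<le> row P b)) \<and>
     (\<exists>b. free_block P y b \<and> colour P b = 1)"

definition young_column :: "('l, 'm) young_pattern_scheme \<Rightarrow> 'l column \<Rightarrow> bool" where
  "young_column P y \<longleftrightarrow> pre_young_column P y \<and> \<not> exceptional P y"

text \<open>
  \<open>shift n\<close> is the \<open>n\<close>-th power of the symmetry of the pattern that moves every block up
  by four rows and rotates by 180 degrees; on letters and indices the rotation is invisible.
\<close>

definition shift :: "int \<Rightarrow> 'l column \<Rightarrow> 'l column" where
  "shift n y = (\<lambda>(l, m). (l, m + n)) ` y"

definition column_equiv ::
    "('l, 'm) young_pattern_scheme \<Rightarrow> ('l column \<times> 'l column) set" where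
  "column_equiv P =
     {(y, y'). young_column P y \<and> young_column P y' \<and> (\<exists>n. y' = shift n y)}"

definition column_class ::
    "('l, 'm) young_pattern_scheme \<Rightarrow> 'l column \<Rightarrow> 'l column set" where
  "column_class P y = column_equiv P `` {y}"

definition column_classes :: "('l, 'm) young_pattern_scheme \<Rightarrow> 'l column set set" where
  "column_classes P = {y. young_column P y} // column_equiv P"

definition vacuum_class :: "('l, 'm) young_pattern_scheme \<Rightarrow> 'l column set" where
  "vacuum_class P = column_class P (vacuum P)"

section \<open>Crystal operators\<close>

text \<open>The value \<open>None\<close> plays the role of the $0$ of crystal theory.\<close>

definition addable ::
    "('l, 'm) young_pattern_scheme \<Rightarrow> nat \<Rightarrow> 'l column \<Rightarrow> 'l block set" where
  "addable P i y = {b. colour P b = i \<and> b \<notin> y \<and> young_column P (insert b y)}"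

definition removable ::
    "('l, 'm) young_pattern_scheme \<Rightarrow> nat \<Rightarrow> 'l column \<Rightarrow> 'l block set" where
  "removable P i y = {b. colour P b = i \<and> b \<in> y \<and> young_column P (y - {b})}"

definition annihilated ::
    "('l, 'm) young_pattern_scheme \<Rightarrow> nat \<Rightarrow> 'l column \<Rightarrow> bool" where
  "annihilated P i y \<longleftrightarrow> (\<exists>j c. special P j = Some c \<and> j \<noteq> i \<and> y \<in> column_class P c)"

definition f_col ::
    "('l, 'm) young_pattern_scheme \<Rightarrow> nat \<Rightarrow> 'l column \<Rightarrow> 'l column option" where
  "f_col P i y =
     (if annihilated P i y \<or> addable P i y = {} then None
      else Some (insert (ARG_MAX (row P) b. b \<in> addable P i y) y))"

definition e_col ::
    "('l, 'm) young_pattern_scheme \<Rightarrow> nat \<Rightarrow> 'l column \<Rightarrow> 'l column option" where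
  "e_col P i y =
     (if annihilated P i y \<or> removable P i y = {} then None
      else Some (y - {ARG_MIN (row P) b. b \<in> removable P i y}))"

text \<open>
  The operators commute with the symmetry, so the image set below is a singleton for every
  equivalence class \<open>X\<close>.
\<close>

definition descend ::
    "('l, 'm) young_pattern_scheme \<Rightarrow> ('l column \<Rightarrow> 'l column option) \<Rightarrow>
     'l column set \<Rightarrow> 'l column set option" where
  "descend P F X = the_elem ((\<lambda>y. map_option (column_class P) (F y)) ` X)"

definition f_cls ::
    "('l, 'm) young_pattern_scheme \<Rightarrow> nat \<Rightarrow> 'l column set \<Rightarrow> 'l column set option" where
  "f_cls P i = descend P (f_col P i)"

definition e_cls ::
    "('l, 'm) young_pattern_scheme \<Rightarrow> nat \<Rightarrow> 'l column set \<Rightarrow> 'l column set option" where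
  "e_cls P i = descend P (e_col P i)"

definition string_length :: "('x \<Rightarrow> 'x option) \<Rightarrow> 'x \<Rightarrow> nat" where
  "string_length F x = Max {n. ((\<lambda>o'. Option.bind o' F) ^^ n) (Some x) \<noteq> None}"

definition phi :: "('l, 'm) young_pattern_scheme \<Rightarrow> nat \<Rightarrow> 'l column set \<Rightarrow> nat" where
  "phi P i = string_length (f_cls P i)"

definition eps :: "('l, 'm) young_pattern_scheme \<Rightarrow> nat \<Rightarrow> 'l column set \<Rightarrow> nat" where
  "eps P i = string_length (e_cls P i)"

section \<open>Tensor product and energy function\<close>

text \<open>The pair \<open>(a, b)\<close> stands for $a \otimes b$.\<close>

definition f_tensor ::
    "('l, 'm) young_pattern_scheme \<Rightarrow> nat \<Rightarrow> 'l column set \<times> 'l column set \<Rightarrow>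
     ('l column set \<times> 'l column set) option" where
  "f_tensor P i = (\<lambda>(a, b).
     if phi P i a > eps P i b then map_option (\<lambda>a'. (a', b)) (f_cls P i a)
     else map_option (\<lambda>b'. (a, b')) (f_cls P i b))"

text \<open>
  These conditions determine \<open>H\<close> uniquely on pairs of elements of \<open>column_classes P\<close>;
  the values of \<open>H\<close> elsewhere are irrelevant.
\<close>

definition energy_function ::
    "('l, 'm) young_pattern_scheme \<Rightarrow> ('l column set \<times> 'l column set \<Rightarrow> int) \<Rightarrow> bool" where
  "energy_function P H \<longleftrightarrow>
     H (vacuum_class P, vacuum_class P) = 0 \<and>
     (\<forall>i\<in>colours. \<forall>a\<in>column_classes P. \<forall>b\<in>column_classes P. \<forall>t.
        f_tensor P i (a, b) = Some t \<longrightarrow>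
        H t - H (a, b) =
          (if i \<noteq> 0 then 0 else if phi P 0 a > eps P 0 b then -1 else 1))"

section \<open>Young walls\<close>

text \<open>
  \<open>Y k\<close> is the column $y_k$ of the wall.  Since the columns of the wall pattern are
  copies of the column pattern at the same height and orientation, blocks in different
  columns occupy the same position iff they are equal as elements of \<open>'l block\<close>.
\<close>

definition young_wall ::
    "('l, 'm) young_pattern_scheme \<Rightarrow> 'l column \<Rightarrow> (nat \<Rightarrow> 'l column) \<Rightarrow> bool" where
  "young_wall P g Y \<longleftrightarrow>
     finite {(k, b). b \<in> (Y k - g) \<union> (g - Y k)} \<and> (\<forall>k. young_column P (Y k))"

definition zero_count ::
    "('l, 'm) young_pattern_scheme \<Rightarrow> 'l column \<Rightarrow> 'l column \<Rightarrow> int" where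
  "zero_count P g y =
     int (card {b \<in> y - g. colour P b = 0}) - int (card {b \<in> g - y. colour P b = 0})"

text \<open>The set of proper Young walls for the highest weight $\Lambda_0$ and ground-state column \<open>g\<close>.\<close>

definition proper_young_walls ::
    "('l, 'm) young_pattern_scheme \<Rightarrow> ('l column set \<times> 'l column set \<Rightarrow> int) \<Rightarrow> 'l column \<Rightarrow>
     (nat \<Rightarrow> 'l column) set" where
  "proper_young_walls P H g =
     {Y. young_wall P g Y \<and>
         (\<forall>k. H (column_class P (Y (k + 1)), column_class P (Y k))
               + zero_count P g (Y (k + 1)) - zero_count P g (Y k) \<le> 0)}"

definition local_right_block :: "(nat \<Rightarrow> 'l column) \<Rightarrow> nat \<Rightarrow> bool" where
  "local_right_block Y k \<longleftrightarrow> (\<forall>b. b \<in> Y (k + 1) \<longrightarrow> b \<in> Y k)"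

end

theory Submission
  imports Defs
begin

text \<open>
  Pre-Young columns modulo shift form a finite automaton, with 28 states in type $E_6^{(2)}$ and 54
  in type $F_4^{(1)}$: every column arises from a full one by adding blocks one at a time.  The
  operators on classes, \<open>phi\<close> and \<open>eps\<close> are read off from its transitions.  The energy of
  \<open>a \<otimes> b\<close> is unchanged by raising with colours 1 to 4; this leads to one of eight highest
  weight pairs, and raising with colour 0 links these to the pair of vacuum classes.  So the energy
  of every pair can be computed.

  Shifting a column changes its number of 0-blocks by one, so for given classes the relative shift
  of the columns \<open>Y (k + 1)\<close> and \<open>Y k\<close> is determined by the value of the expression in the
  properness condition.  If this value is 0, inclusion is checked for each pair of classes.  A block of index
  \<open>m\<close> forces all blocks of index at most \<open>m - 2\<close>, so inclusion persists if the value is at most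
  -2, but not necessarily if it is -1.
\<close>

section \<open>Columns up to shift\<close>

text \<open>An energy function is given only through its change along arrows of the tensor crystal.
  These arrows depend on string lengths, which are maxima over iterates of operators on classes of
  infinite sets. To compute with them, every table entry has to be tied to these definitions. Arrows
  are followed backwards because raising with colours 1 to 4 soon gets stuck. For these colours the
  non-exceptional states form one component V of 26 or 52 states and the isolated vacuum state 1.
  The eight stuck pairs are five in V \<otimes> V and one each in V \<otimes> 1, 1 \<otimes> V and 1
  \<otimes> 1. The value -1 escapes for a reason of shape: a block of index m in column k + 1 then
  only yields the block of index m + 1 with the same letter in column k. That block forces all
  indices up to m - 1 and just misses m.\<close>

lemma mem_shift [simp]: "(l, m) \<in> shift n y \<longleftrightarrow> (l, m - n) \<in> y"
  by (force simp: shift_def)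

lemma shift_shift [simp]: "shift m (shift n y) = shift (m + n) y"
  by (auto simp: algebra_simps)

lemma shift_0 [simp]: "shift 0 y = y"
  by auto

lemma shift_eq_iff: "shift n x = y \<longleftrightarrow> x = shift (- n) y"
  by auto

lemma shift_insert: "shift n (insert (l, m) y) = insert (l, m + n) (shift n y)"
  by auto

lemma shift_Diff: "shift n (y - {(l, m)}) = shift n y - {(l, m + n)}"
  by auto

lemma shift_mono_iff: "shift p x \<subseteq> shift q y \<longleftrightarrow> shift (p - q) x \<subseteq> y"
proof -
  have *: "shift n x \<subseteq> shift n y" if "x \<subseteq> y" for n and x y :: "'a column"
    using that by auto
  show ?thesis
    using *[of "shift p x" "shift q y" "- q"] *[of "shift (p - q) x" y q] by auto
qed

section \<open>Extremal blocks and string lengths\<close>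

lemma arg_max_eqI:
  fixes r :: "'b \<Rightarrow> int"
  assumes "b \<in> A" "\<And>b'. b' \<in> A \<Longrightarrow> b' = b \<or> r b' < r b"
  shows "(ARG_MAX r b. b \<in> A) = b"
  unfolding arg_max_def by (rule some_equality) (use assms in \<open>force simp: is_arg_max_def\<close>)+

lemma arg_min_eqI:
  fixes r :: "'b \<Rightarrow> int"
  assumes "b \<in> A" "\<And>b'. b' \<in> A \<Longrightarrow> b' = b \<or> r b < r b'"
  shows "(ARG_MIN r b. b \<in> A) = b"
  unfolding arg_min_def by (rule some_equality) (use assms in \<open>force simp: is_arg_min_def\<close>)+

text \<open>The recursion makes \<open>h\<close> drop by one along each \<open>g\<close>-step, so
  the iterates of \<open>F\<close> survive exactly \<open>h s\<close> steps and cycles are excluded.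
  The set of surviving lengths is therefore \<open>{..h s}\<close>, which is what makes the
  \<open>Max\<close> in \<open>string_length\<close> meaningful.\<close>

lemma string_length_eq:
  assumes F: "\<And>s. s \<in> S \<Longrightarrow> F (c s) = map_option c (g s)"
    and closed: "\<And>s t. s \<in> S \<Longrightarrow> g s = Some t \<Longrightarrow> t \<in> S"
    and h: "\<And>s. s \<in> S \<Longrightarrow> h s = (case g s of None \<Rightarrow> 0 | Some t \<Rightarrow> Suc (h t))"
    and s: "s \<in> S"
  shows "string_length F (c s) = h s"
proof -
  let ?B = "\<lambda>o'. Option.bind o' F"
  have none: "(?B ^^ n) None = None" for n
    by (induction n) auto
  have "(?B ^^ n) (Some (c s)) \<noteq> None \<longleftrightarrow> n \<le> h s" for n
    using s
  proof (induction n arbitrary: s)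
    case (Suc n)
    have "(?B ^^ Suc n) (Some (c s)) = (?B ^^ n) (F (c s))"
      by (subst funpow_Suc_right) simp
    then show ?case
      using Suc.IH F[OF Suc.prems] h[OF Suc.prems] closed[OF Suc.prems]
      by (cases "g s") (auto simp: none)
  qed simp
  then have "{n. (?B ^^ n) (Some (c s)) \<noteq> None} = {..h s}"
    by auto
  then show ?thesis
    unfolding string_length_def by (auto intro: Max_eqI)
qed

text \<open>\<open>height\<close> refines \<open>level\<close>: in type $F_4^{(1)}$ the double-height row $4m+3$ counts as two rows,
  whence the period 5.\<close>

locale periodic_pattern =
  fixes P :: "('l, 'm) young_pattern_scheme"
    and height :: "'l \<Rightarrow> int"
    and z :: 'l
  assumes finite_letters: "finite (UNIV :: 'l set)"
    and level_range: "0 \<le> level P l" "level P l \<le> 3"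
    and ex_level_3: "\<exists>l. level P l = 3"
    and zero_letter: "letter_colour P l = 0 \<longleftrightarrow> l = z"
    and rests_shift: "rests_on P (l, m + n) = shift n (rests_on P (l, m))"
    and rests_nonempty: "rests_on P b \<noteq> {}"
    and rests_index: "c \<in> rests_on P b \<Longrightarrow> snd c = snd b \<or> snd c = snd b - 1"
    and rests_height:
      "c \<in> rests_on P b \<Longrightarrow> 5 * snd c + height (fst c) < 5 * snd b + height (fst b)"
    and full_below:
      "pre_young_column P y \<Longrightarrow> (l, m) \<in> y \<Longrightarrow> m' \<le> m - 2 \<Longrightarrow> (l', m') \<in> y"
begin

section \<open>Invariance of all notions under shifts\<close>

lemma row_shift [simp]: "row P (l, m + n) = row P (l, m) + 4 * n"
  by (simp add: row_def)

lemma colour_simp [simp]: "colour P (l, m) = letter_colour P l"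
  by (simp add: colour_def)

lemma pre_young_shiftI:
  assumes "pre_young_column P y"
  shows "pre_young_column P (shift n y)"
proof -
  obtain N where N: "\<And>b. b \<in> y \<Longrightarrow> row P b \<le> N"
    using assms unfolding pre_young_column_def by blast
  have "row P b \<le> N + 4 * n" if "b \<in> shift n y" for b
    using that N[of "(fst b, snd b - n)"] by (cases b) (auto simp: row_def)
  moreover have "rests_on P b \<subseteq> shift n y" if "b \<in> shift n y" for b
  proof -
    obtain l m where b: "b = (l, m)" by force
    then have "rests_on P (l, m - n) \<subseteq> y"
      using assms that unfolding pre_young_column_def by auto
    then show ?thesis
      using rests_shift[of l "m - n" n] by (force simp: b)
  qed
  moreover have "shift n y \<noteq> {}"
    using assms unfolding pre_young_column_def shift_def by auto
  ultimately show ?thesis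
    unfolding pre_young_column_def by blast
qed

lemma pre_young_shift [simp]: "pre_young_column P (shift n y) \<longleftrightarrow> pre_young_column P y"
  using pre_young_shiftI[of y n] pre_young_shiftI[of "shift n y" "- n"] by auto

lemma free_shift [simp]: "free_block P (shift n y) (l, m) \<longleftrightarrow> free_block P y (l, m - n)"
proof -
  have "shift n y - {(l, m)} = shift n (y - {(l, m - n)})"
    by auto
  then show ?thesis
    by (simp add: free_block_def)
qed

lemma exceptional_shiftI:
  assumes "exceptional P y"
  shows "exceptional P (shift n y)"
proof -
  let ?top = "\<lambda>y b. free_block P y b \<and> colour P b = 2 \<and> (\<forall>b'\<in>y. row P b' \<le> row P b)"
  have top: "?top (shift n y) (l, m) \<longleftrightarrow> ?top y (l, m - n)" for l m
  proof -
    have "(\<forall>b'\<in>shift n y. row P b' \<le> row P (l, m)) \<longleftrightarrow> (\<forall>b'\<in>y. row P b' \<le> row P (l, m - n))"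
      by (force simp: shift_def row_def)
    then show ?thesis by simp
  qed
  obtain l m where b: "?top y (l, m)" "\<And>l' m'. ?top y (l', m') \<Longrightarrow> (l', m') = (l, m)"
    using assms unfolding exceptional_def by (metis surj_pair)
  have "\<exists>!b. ?top (shift n y) b"
  proof (rule ex1I[of _ "(l, m + n)"])
    show "?top (shift n y) (l, m + n)"
      using b(1) by (subst top) simp
    fix b' assume b': "?top (shift n y) b'"
    obtain l' m' where "b' = (l', m')" by force
    with b' top b(2) show "b' = (l, m + n)" by fastforce
  qed
  moreover obtain l' m' where "free_block P y (l', m')" "colour P (l', m') = 1"
    using assms unfolding exceptional_def by (metis surj_pair)
  then have "free_block P (shift n y) (l', m' + n) \<and> colour P (l', m' + n) = 1"
    by simp
  ultimately show ?thesis
    using assms unfolding exceptional_def by (metis pre_young_shift)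
qed

lemma young_shift [simp]: "young_column P (shift n y) \<longleftrightarrow> young_column P y"
  using exceptional_shiftI[of y n] exceptional_shiftI[of "shift n y" "- n"]
  by (auto simp: young_column_def)

lemma mem_column_class:
  "y' \<in> column_class P y \<longleftrightarrow> young_column P y \<and> (\<exists>n. y' = shift n y)"
  by (auto simp: column_class_def column_equiv_def)

lemma column_class_shift [simp]: "column_class P (shift n y) = column_class P y"
proof -
  have "(\<exists>k. y' = shift k (shift n y)) \<longleftrightarrow> (\<exists>k. y' = shift k y)" for y'
    by (metis (no_types) shift_shift diff_add_cancel)
  then show ?thesis
    by (auto simp: mem_column_class simp del: shift_shift)
qed

lemma addable_shift: "addable P i (shift n y) = shift n (addable P i y)"
proof -
  have "insert (l, m) (shift n y) = shift n (insert (l, m - n) y)" for l m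
    by (auto simp: shift_insert)
  then show ?thesis
    by (auto simp: addable_def)
qed

lemma removable_shift: "removable P i (shift n y) = shift n (removable P i y)"
proof -
  have "shift n y - {(l, m)} = shift n (y - {(l, m - n)})" for l m
    by (auto simp: shift_Diff)
  then show ?thesis
    by (auto simp: removable_def)
qed

section \<open>Building columns block by block\<close>

lemma pre_young_insert_iff:
  assumes "pre_young_column P y" "b \<notin> y"
  shows "pre_young_column P (insert b y) \<longleftrightarrow> rests_on P b \<subseteq> y"
proof
  assume "pre_young_column P (insert b y)"
  moreover have "b \<notin> rests_on P b"
    using rests_height[of b b] by auto
  ultimately show "rests_on P b \<subseteq> y"
    unfolding pre_young_column_def by blast
next
  assume *: "rests_on P b \<subseteq> y"
  obtain N where "\<forall>b'\<in>y. row P b' \<le> N"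
    using assms unfolding pre_young_column_def by blast
  then have "\<forall>b'\<in>insert b y. row P b' \<le> max N (row P b)"
    by auto
  with * assms show "pre_young_column P (insert b y)"
    unfolding pre_young_column_def by blast
qed

text \<open>A missing block of least height serves: what it rests on lies in \<open>y\<close> by
  closure and is strictly lower, so none of it can be missing from \<open>x\<close>.\<close>

lemma ex_addable_between:
  assumes "pre_young_column P y" "x \<subseteq> y" "finite (y - x)" "x \<noteq> y"
  obtains b where "b \<in> y - x" "rests_on P b \<subseteq> x"
proof -
  let ?h = "\<lambda>b. 5 * snd b + height (fst b)"
  have "Min (?h ` (y - x)) \<in> ?h ` (y - x)"
    using assms by (intro Min_in) auto
  then obtain b where b: "Min (?h ` (y - x)) = ?h b" "b \<in> y - x"
    by (rule imageE)
  have min: "?h b \<le> ?h c" if "c \<in> y - x" for c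
    unfolding b(1)[symmetric] using that assms(3) by (intro Min_le) auto
  have "rests_on P b \<subseteq> x"
  proof
    fix c assume c: "c \<in> rests_on P b"
    then have "c \<in> y"
      using assms b unfolding pre_young_column_def by blast
    then show "c \<in> x"
      using rests_height[OF c] min[of c] by force
  qed
  then show ?thesis
    using b(2) that by blast
qed

end

text \<open>The normal form of a column up to shift. If M is the highest index, all indices up to M
  - 2 are full, so at most two consecutive indices are partially filled. They are placed at 0 and 1,
  and index 0 is required not to be full, which fixes the shift. Lists instead of sets keep the form
  executable.\<close>

definition window :: "'l list \<times> 'l list \<Rightarrow> 'l column" where
  "window r = {(l, m). m < 0 \<or> m = 0 \<and> l \<in> set (fst r) \<or> m = 1 \<and> l \<in> set (snd r)}"

lemma mem_window [simp]:
  "(l, m) \<in> window r \<longleftrightarrow> m < 0 \<or> m = 0 \<and> l \<in> set (fst r) \<or> m = 1 \<and> l \<in> set (snd r)"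
  by (simp add: window_def)

text \<open>Unlike membership in \<open>window r\<close>, this can be evaluated by \<open>code_simp\<close>.\<close>

definition in_window :: "'l list \<times> 'l list \<Rightarrow> 'l block \<Rightarrow> bool" where
  "in_window r = (\<lambda>(l, m). m < 0 \<or> m = 0 \<and> l \<in> set (fst r) \<or> m = 1 \<and> l \<in> set (snd r))"

lemma in_window_iff: "in_window r b \<longleftrightarrow> b \<in> window r"
  by (cases b) (simp add: in_window_def)

text \<open>One predicate for both operators: \<open>lt\<close> is \<open><\<close> for adding,
  where the highest block is chosen, and \<open>>\<close> for removing, where the lowest is. Moves
  into \<open>exc\<close> count as absent because the result is not a Young column. The first test
  expresses the extra zeros at the classes of the \<open>y_{r_j}\<close>.\<close>

definition arrow_ok ::
    "(int \<Rightarrow> int \<Rightarrow> bool) \<Rightarrow> ('l block \<Rightarrow> nat) \<Rightarrow> ('l block \<Rightarrow> int) \<Rightarrow> (nat \<times> 's) list \<Rightarrow>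
     's \<Rightarrow> nat \<Rightarrow> 's \<Rightarrow> ('l block \<times> 's \<times> int) list \<Rightarrow> 's option \<Rightarrow> bool" where
  "arrow_ok lt clr rw specials exc i s moves r \<longleftrightarrow>
     (if \<exists>(j, t)\<in>set specials. j \<noteq> i \<and> t = s then r = None
      else case r of
        None \<Rightarrow> (\<forall>(b, t, k)\<in>set moves. clr b = i \<longrightarrow> t = exc)
      | Some t \<Rightarrow> t \<noteq> exc \<and>
          (\<exists>(b, t', k)\<in>set moves. t' = t \<and> clr b = i \<and>
            (\<forall>(b', t'', k')\<in>set moves. clr b' = i \<longrightarrow> t'' = exc \<or> b' = b \<or> lt (rw b') (rw b))))"

text \<open>A state \<open>s\<close> stands for the shift class of \<open>window (rows s)\<close>.  An entry \<open>(b, t, n)\<close> of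
  \<open>up s\<close> (of \<open>down s\<close>) says that adding (removing) \<open>b\<close> leads to the shift by \<open>n\<close> of the
  column of \<open>t\<close>; exceptional columns form the state \<open>exc\<close>.  The lists \<open>f s\<close>, \<open>e s\<close>, \<open>phis s\<close>,
  \<open>epss s\<close> are indexed by colours.\<close>

locale column_automaton = periodic_pattern P height z
  for P :: "('l, 'm) young_pattern_scheme" and height :: "'l \<Rightarrow> int" and z :: 'l +
  fixes letters :: "'l list"
    and states :: "'s list"
    and rows :: "'s \<Rightarrow> 'l list \<times> 'l list"
    and up down :: "'s \<Rightarrow> ('l block \<times> 's \<times> int) list"
    and exc vac :: 's
    and specials :: "(nat \<times> 's) list"
    and f e :: "'s \<Rightarrow> 's option list"
    and phis epss :: "'s \<Rightarrow> nat list"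
  assumes letters: "set letters = UNIV"
    and states: "set states = UNIV"
    and rows_distinct: "distinct (map rows states)"
    and rows_check: "\<forall>s\<in>set states.
      filter (\<lambda>l. l \<in> set (fst (rows s))) letters = fst (rows s) \<and>
      filter (\<lambda>l. l \<in> set (snd (rows s))) letters = snd (rows s) \<and>
      (\<exists>l\<in>set letters. l \<notin> set (fst (rows s)))"
    and empty_check: "\<exists>s\<in>set states. rows s = ([], [])"
    and pre_young_check: "\<forall>s\<in>set states.
      (\<forall>l\<in>set (fst (rows s)). \<forall>c\<in>rests_on P (l, 0). in_window (rows s) c) \<and>
      (\<forall>l\<in>set (snd (rows s)). \<forall>c\<in>rests_on P (l, 1). in_window (rows s) c)"
    and up_complete_check: "\<forall>s\<in>set states. \<forall>m\<in>set [0, 1, 2]. \<forall>l\<in>set letters.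
      in_window (rows s) (l, m) \<or> (\<exists>c\<in>rests_on P (l, m). \<not> in_window (rows s) c) \<or>
      (l, m) \<in> set (map fst (up s))"
    and up_sound_check: "\<forall>s\<in>set states. \<forall>(b, t, n)\<in>set (up s).
      0 \<le> n \<and> n \<le> 1 \<and> 0 \<le> snd b \<and> snd b \<le> 2 \<and> \<not> in_window (rows s) b \<and>
      (\<forall>m\<in>set [0, 1, 2]. \<forall>l\<in>set letters.
        (l, m) = b \<or> in_window (rows s) (l, m) \<longleftrightarrow> in_window (rows t) (l, m - n))"
    and up_down_check: "\<forall>s\<in>set states. \<forall>(b, t, n)\<in>set (up s).
      ((fst b, snd b - n), s, - n) \<in> set (down t)"
    and down_up_check: "\<forall>s\<in>set states. \<forall>(b, t, n)\<in>set (down s).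
      ((fst b, snd b - n), s, - n) \<in> set (up t)"
    and exc_check: "\<forall>s\<in>set states. (\<exists>(b, _)\<in>set (down s). colour P b = 1) \<and>
      length (filter (\<lambda>(b, _). colour P b = 2 \<and> -1 \<le> row P b \<and>
        (\<forall>l\<in>set (fst (rows s)). level P l \<le> row P b) \<and>
        (\<forall>l\<in>set (snd (rows s)). level P l + 4 \<le> row P b)) (down s)) = 1 \<longleftrightarrow> s = exc"
    and down_distinct_check: "\<forall>s\<in>set states. distinct (map fst (down s))"
    and vac: "vac \<noteq> exc" "vacuum P = window (rows vac)"
    and special_Some: "special P j = Some c \<Longrightarrow>
      \<exists>t k. (j, t) \<in> set specials \<and> c = shift k (window (rows t))"
    and specials: "(j, t) \<in> set specials \<Longrightarrow>
      t \<noteq> exc \<and> (\<exists>k. special P j = Some (shift k (window (rows t))))"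
    and table_check: "\<forall>s\<in>set states.
      length (e s) = 5 \<and> length (phis s) = 5 \<and> length (epss s) = 5 \<and>
      (s \<noteq> exc \<longrightarrow> (\<forall>i\<in>colours.
        arrow_ok (<) (colour P) (row P) specials exc i s (up s) (f s ! i) \<and>
        arrow_ok (>) (colour P) (row P) specials exc i s (down s) (e s ! i) \<and>
        (case e s ! i of None \<Rightarrow> epss s ! i = 0
          | Some t \<Rightarrow> epss s ! i = Suc (epss t ! i) \<and> f t ! i = Some s) \<and>
        (case f s ! i of None \<Rightarrow> phis s ! i = 0 | Some t \<Rightarrow> phis s ! i = Suc (phis t ! i))))"
begin

section \<open>Pre-Young columns as states of the automaton\<close>

lemma empty_state: "\<exists>s. rows s = ([], [])"
  using empty_check by blast

lemma not_full: "\<exists>l. l \<notin> set (fst (rows s))"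
  using rows_check states by blast

text \<open>The row lists are filtered copies of \<open>letters\<close>, hence listed in one fixed
  order, so equal sets of letters give equal lists.\<close>

lemma window_inj:
  assumes "window (rows s) = window (rows t)"
  shows "s = t"
proof -
  have "(l, m) \<in> window (rows s) \<longleftrightarrow> (l, m) \<in> window (rows t)" for l m
    using assms by simp
  from this[of _ 0] this[of _ 1] have "set (fst (rows s)) = set (fst (rows t))"
    "set (snd (rows s)) = set (snd (rows t))"
    by auto
  then have "fst (rows s) = fst (rows t)" "snd (rows s) = snd (rows t)"
    using rows_check states by (metis UNIV_I)+
  then show ?thesis
    using rows_distinct states by (simp add: distinct_map inj_on_def prod_eq_iff)
qed

lemma pre_young: "pre_young_column P (window (rows s))"
proof -
  \<comment> \<open>7 is the row of a level 3 letter of index 1.\<close>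
  have "row P b \<le> 7" if "b \<in> window (rows s)" for b
    using that level_range[of "fst b"] by (cases b) (auto simp: row_def)
  moreover have "rests_on P b \<subseteq> window (rows s)" if b: "b \<in> window (rows s)" for b
  proof
    fix c assume c: "c \<in> rests_on P b"
    obtain l m l' m' where lm: "b = (l, m)" "c = (l', m')"
      by (metis surj_pair)
    consider "m < 0" | "m = 0" "l \<in> set (fst (rows s))" | "m = 1" "l \<in> set (snd (rows s))"
      using b by (auto simp: lm)
    then show "c \<in> window (rows s)"
    proof cases
      case 1
      then show ?thesis
        using rests_index[OF c] by (auto simp: lm)
    qed (use pre_young_check states c in \<open>unfold lm in_window_iff, blast+\<close>)
  qed
  moreover have "(z, -1) \<in> window (rows s)"
    by simp
  ultimately show ?thesis
    unfolding pre_young_column_def by blast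
qed

lemma up_complete:
  assumes "(l, m) \<notin> window (rows s)" "rests_on P (l, m) \<subseteq> window (rows s)" "m \<in> {0, 1, 2}"
  shows "\<exists>t n. ((l, m), t, n) \<in> set (up s)"
proof -
  have "in_window (rows s) (l, m) \<or> (\<exists>c\<in>rests_on P (l, m). \<not> in_window (rows s) c) \<or>
      (l, m) \<in> set (map fst (up s))"
    using bspec[OF bspec[OF bspec[OF up_complete_check, of s], of m], of l] states letters assms(3)
    by simp
  then have "(l, m) \<in> fst ` set (up s)"
    using assms(1,2) unfolding in_window_iff set_map by blast
  then show ?thesis
    by (metis imageE prod.collapse)
qed

lemma up_sound:
  assumes "(b, t, n) \<in> set (up s)"
  shows "b \<notin> window (rows s) \<and> insert b (window (rows s)) = shift n (window (rows t))"
proof -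
  have n: "0 \<le> n" "n \<le> 1" "0 \<le> snd b" "snd b \<le> 2" and notin: "b \<notin> window (rows s)"
    and eq: "\<And>l m. m \<in> set [0, 1, 2] \<Longrightarrow>
      (l, m) = b \<or> (l, m) \<in> window (rows s) \<longleftrightarrow> (l, m - n) \<in> window (rows t)"
    using bspec[OF bspec[OF up_sound_check] assms, unfolded prod.case in_window_iff letters] states
    by blast+
  have "(l, m) \<in> insert b (window (rows s)) \<longleftrightarrow> (l, m) \<in> shift n (window (rows t))" for l m
  proof -
    \<comment> \<open>Below 0 both sides are full, since \<open>n\<close> is nonnegative. Above 2
      both are empty, since a window ends at index 1 and \<open>n\<close> is at most 1. Only three
      indices need checking.\<close>
    consider "m < 0" | "m \<in> set [0, 1, 2]" | "m > 2"
      by force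
    then show ?thesis
      by cases (use n eq[of m l] in \<open>auto simp del: set_simps\<close>)
  qed
  then have "insert b (window (rows s)) = shift n (window (rows t))"
    by (intro set_eqI) (simp only: split_paired_all)
  then show ?thesis
    using notin by blast
qed

text \<open>Both lists hold the same arrows: undoing a removal that leaves the shift by
  \<open>n\<close> of the column of \<open>s\<close> means adding the block in the coordinates of
  \<open>s\<close>, which moves everything by \<open>- n\<close>. Completeness of
  \<open>down\<close> is thus inherited from \<open>up\<close>.\<close>

lemma down_up: "((l, m), s, n) \<in> set (down t) \<longleftrightarrow> ((l, m - n), t, - n) \<in> set (up s)"
proof
  show "((l, m - n), t, - n) \<in> set (up s)" if "((l, m), s, n) \<in> set (down t)"
    using down_up_check states that by fastforce
  show "((l, m), s, n) \<in> set (down t)" if "((l, m - n), t, - n) \<in> set (up s)"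
    using up_down_check states that by fastforce
qed

lemma exc: "(\<exists>(b, _)\<in>set (down s). colour P b = 1) \<and>
    length (filter (\<lambda>(b, _). colour P b = 2 \<and> -1 \<le> row P b \<and>
      (\<forall>l\<in>set (fst (rows s)). level P l \<le> row P b) \<and>
      (\<forall>l\<in>set (snd (rows s)). level P l + 4 \<le> row P b)) (down s)) = 1 \<longleftrightarrow> s = exc"
  using exc_check states by blast

lemma down_distinct: "distinct (map fst (down s))"
  using down_distinct_check states by blast

lemma table_length: "length (e s) = 5" "length (phis s) = 5" "length (epss s) = 5"
  using table_check states by blast+

lemma
  assumes "s \<noteq> exc" "i \<in> colours"
  shows f_ok: "arrow_ok (<) (colour P) (row P) specials exc i s (up s) (f s ! i)"
    and e_ok: "arrow_ok (>) (colour P) (row P) specials exc i s (down s) (e s ! i)"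
    and e_inverse: "e s ! i = Some t \<Longrightarrow> f t ! i = Some s"
    and phi_ok: "phis s ! i = (case f s ! i of None \<Rightarrow> 0 | Some t \<Rightarrow> Suc (phis t ! i))"
    and eps_ok: "epss s ! i = (case e s ! i of None \<Rightarrow> 0 | Some t \<Rightarrow> Suc (epss t ! i))"
proof -
  have "s \<in> set states"
    using states by simp
  note check = bspec[OF mp[OF conjunct2[OF conjunct2[OF conjunct2[OF
    bspec[OF table_check this]]]] assms(1)] assms(2)]
  show "arrow_ok (<) (colour P) (row P) specials exc i s (up s) (f s ! i)"
    "arrow_ok (>) (colour P) (row P) specials exc i s (down s) (e s ! i)"
    using check by blast+
  show "e s ! i = Some t \<Longrightarrow> f t ! i = Some s"
    using check by simp
  show "phis s ! i = (case f s ! i of None \<Rightarrow> 0 | Some t \<Rightarrow> Suc (phis t ! i))"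
    using check by (auto split: option.splits)
  show "epss s ! i = (case e s ! i of None \<Rightarrow> 0 | Some t \<Rightarrow> Suc (epss t ! i))"
    using check by (auto split: option.splits)
qed

abbreviation col :: "'s \<Rightarrow> 'l column" where
  "col s \<equiv> window (rows s)"

abbreviation cls :: "'s \<Rightarrow> 'l column set" where
  "cls s \<equiv> column_class P (col s)"

text \<open>The lowest index with a missing letter is 0 in a window and \<open>n\<close> in its
  shift by \<open>n\<close>, so the shift can be read off from the column.\<close>

lemma shift_col_inj:
  assumes "shift m (col s) = shift n (col t)"
  shows "s = t \<and> m = n"
proof -
  have "m \<le> n" if eq: "shift m (col s) = shift n (col t)" for s t and m n :: int
  proof (rule ccontr)
    assume "\<not> m \<le> n"
    obtain l where l: "l \<notin> set (fst (rows t))"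
      using not_full by blast
    have "(l, n) \<in> shift m (col s)"
      using \<open>\<not> m \<le> n\<close> by simp
    then show False
      using l by (subst (asm) eq) simp
  qed
  from this[OF assms] this[OF assms[symmetric]] have "m = n"
    by simp
  with assms have "col s = col t"
    by (metis shift_eq_iff shift_shift add.left_inverse shift_0)
  then show ?thesis
    using window_inj \<open>m = n\<close> by blast
qed

text \<open>The checks for indices 0, 1 and 2 cover everything. Negative indices are already full,
  and an addable block rests on something of index at most 1, hence has index at most 2.\<close>

lemma addable_col:
  assumes "(l, m) \<notin> col s" "rests_on P (l, m) \<subseteq> col s"
  obtains t n where "((l, m), t, n) \<in> set (up s)"
proof -
  obtain l' m' where c: "(l', m') \<in> rests_on P (l, m)"
    using rests_nonempty[of "(l, m)"] by auto
  then have "(l', m') \<in> col s"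
    using assms(2) by blast
  then have "m' \<le> 1"
    by auto
  moreover have "m \<le> m' + 1"
    using rests_index[OF c] by auto
  ultimately have "m \<le> 2" "0 \<le> m"
    using assms(1) by auto
  then have "m \<in> {0, 1, 2}"
    by auto
  then show ?thesis
    using up_complete assms that by blast
qed

text \<open>A full column lies inside \<open>y\<close> and differs from it by finitely many blocks.
  These are added one at a time, and each addition is an arrow of the automaton, so one never leaves
  the shifts of its columns.\<close>

lemma classification:
  assumes y: "pre_young_column P y"
  obtains s n where "y = shift n (col s)"
proof -
  obtain s0 where s0: "rows s0 = ([], [])"
    using empty_state by blast
  obtain l0 m0 where "(l0, m0) \<in> y"
    using y unfolding pre_young_column_def by (metis ex_in_conv surj_pair)
  \<comment> \<open>The column of \<open>s0\<close> consists of all blocks of negative index. Its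
    shift by \<open>m0 - 1\<close> consists of those of index at most \<open>m0 - 2\<close>, which
    the block \<open>(l0, m0)\<close> forces into \<open>y\<close>.\<close>
  then have base: "shift (m0 - 1) (col s0) \<subseteq> y"
    using full_below[OF y, of l0 m0] by (auto simp: s0)
  obtain N where N: "\<And>b. b \<in> y \<Longrightarrow> row P b \<le> N"
    using y unfolding pre_young_column_def by blast
  have "y - shift (m0 - 1) (col s0) \<subseteq> UNIV \<times> {m0 - 1..\<bar>N\<bar>}"
  proof
    fix b assume b: "b \<in> y - shift (m0 - 1) (col s0)"
    obtain l m where lm: "b = (l, m)" by force
    have "4 * m \<le> N"
      using N[of b] b level_range[of l] by (auto simp: lm row_def)
    then show "b \<in> UNIV \<times> {m0 - 1..\<bar>N\<bar>}"
      using b by (auto simp: lm)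
  qed
  then have "finite (y - shift (m0 - 1) (col s0))"
    using finite_letters by (meson finite_SigmaI finite_atLeastAtMost_int finite_subset)
  with base have "\<exists>s n. y = shift n (col s)"
  proof (induction "card (y - shift (m0 - 1) (col s0))" arbitrary: s0 m0 rule: less_induct)
    case less
    let ?x = "shift (m0 - 1) (col s0)"
    show ?case
    proof (cases "?x = y")
      case False
      then obtain l m where b: "(l, m) \<in> y - ?x" "rests_on P (l, m) \<subseteq> ?x"
        using ex_addable_between[OF y] less.prems by (metis surj_pair)
      have "rests_on P (l, m - (m0 - 1)) = shift (- (m0 - 1)) (rests_on P (l, m))"
        using rests_shift[of l m "- (m0 - 1)"] by (metis add_uminus_conv_diff)
      also have "\<dots> \<subseteq> col s0"
        using b(2) shift_mono_iff[of "1 - m0" "rests_on P (l, m)" 0 "col s0"]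
          shift_mono_iff[of 0 "rests_on P (l, m)" "m0 - 1" "col s0"] by simp
      finally have "rests_on P (l, m - (m0 - 1)) \<subseteq> col s0" .
      then obtain t n where "((l, m - (m0 - 1)), t, n) \<in> set (up s0)"
        using b(1) by (auto elim: addable_col[rotated])
      then have "insert (l, m) ?x = shift (m0 - 1 + n) (col t)"
        using up_sound[of "(l, m - (m0 - 1))" t n s0] shift_insert[of "m0 - 1" l "m - (m0 - 1)" "col s0"]
        by simp
      \<comment> \<open>The shift is regrouped to the form \<open>m0 - 1\<close> of the induction
        hypothesis, with \<open>m0 + n\<close> for \<open>m0\<close>.\<close>
      then have eq: "insert (l, m) ?x = shift ((m0 + n) - 1) (col t)"
        by (simp add: algebra_simps)
      have "y - insert (l, m) ?x \<subset> y - ?x"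
        using b(1) by blast
      then have "card (y - insert (l, m) ?x) < card (y - ?x)"
        using less.prems(2) psubset_card_mono by blast
      then show ?thesis
        using less.hyps[of "m0 + n" t] less.prems b(1) eq by (metis Diff_iff finite_Diff2 finite_insert
            insert_subset finite_Diff_insert)
    qed blast
  qed
  then show ?thesis
    using that by blast
qed

text \<open>What is left after removing a free block is again a shifted state by the classification.
  Putting the block back is an arrow in \<open>up\<close>, whose reverse is listed in
  \<open>down\<close>.\<close>

lemma free_col_iff: "free_block P (col t) b \<longleftrightarrow> (\<exists>s n. (b, s, n) \<in> set (down t))"
proof -
  obtain l m where b: "b = (l, m)" by force
  show ?thesis
  proof
    assume free: "free_block P (col t) b"
    then obtain s n where s: "col t - {b} = shift n (col s)"
      unfolding free_block_def using classification by metis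
    have "col t = insert (l, m) (shift n (col s))"
      using free unfolding s[symmetric] by (auto simp: free_block_def b)
    then have eq: "insert (l, m - n) (col s) = shift (- n) (col t)"
      using shift_insert[of "- n" l m "shift n (col s)"] by simp
    have "(l, m) \<notin> shift n (col s)"
      unfolding s[symmetric] by (simp add: b)
    then have notin: "(l, m - n) \<notin> col s"
      by simp
    have "rests_on P (l, m - n) \<subseteq> col s"
      using pre_young_insert_iff[OF pre_young notin] eq pre_young by simp
    then obtain t' k where up: "((l, m - n), t', k) \<in> set (up s)"
      using notin addable_col by blast
    then have "shift k (col t') = shift (- n) (col t)"
      using up_sound eq by metis
    then show "\<exists>s n. (b, s, n) \<in> set (down t)"
      using up shift_col_inj b down_up by metis
  next
    assume "\<exists>s n. (b, s, n) \<in> set (down t)"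
    then obtain s n where "((l, m - n), t, - n) \<in> set (up s)"
      using b down_up by blast
    then have "(l, m - n) \<notin> col s" "insert (l, m - n) (col s) = shift (- n) (col t)"
      using up_sound by blast+
    then have "col t = insert (l, m) (shift n (col s))" "(l, m) \<notin> shift n (col s)"
      using shift_insert[of n l "m - n" "col s"] by auto
    then show "free_block P (col t) b"
      using pre_young by (simp add: free_block_def b)
  qed
qed

lemma down_sound:
  assumes "((l, m), s, n) \<in> set (down t)"
  shows "(l, m) \<in> col t \<and> col t - {(l, m)} = shift n (col s)"
proof -
  have "(l, m - n) \<notin> col s" "insert (l, m - n) (col s) = shift (- n) (col t)"
    using up_sound assms down_up by blast+
  then have "col t = insert (l, m) (shift n (col s))" "(l, m) \<notin> shift n (col s)"
    using shift_insert[of n l "m - n" "col s"] by auto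
  then show ?thesis
    by simp
qed

text \<open>The filtered list in the check enumerates the free 2-blocks of the highest row. Its
  entries have distinct blocks, so length 1 expresses unique existence.\<close>

lemma exceptional_col: "exceptional P (col s) \<longleftrightarrow> s = exc"
proof -
  let ?top = "\<lambda>b. colour P b = 2 \<and> (\<forall>b'\<in>col s. row P b' \<le> row P b)"
  let ?Q = "\<lambda>b. colour P b = 2 \<and> -1 \<le> row P b \<and>
        (\<forall>l\<in>set (fst (rows s)). level P l \<le> row P b) \<and>
        (\<forall>l\<in>set (snd (rows s)). level P l + 4 \<le> row P b)"
  have top: "?top b \<longleftrightarrow> ?Q b" for b
  proof
    assume b: "?top b"
    obtain l where l: "level P l = 3"
      using ex_level_3 by blast
    \<comment> \<open>Row -1 is always occupied, whence the bound -1 in the check. Lower rows need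
      no comparison, and the indices 0 and 1 are compared letter by letter.\<close>
    have "(l, -1) \<in> col s"
      by simp
    then have "row P (l, -1) \<le> row P b"
      using b by blast
    moreover have "row P (l', 0) \<le> row P b" if "l' \<in> set (fst (rows s))" for l'
      using b that by auto
    moreover have "row P (l', 1) \<le> row P b" if "l' \<in> set (snd (rows s))" for l'
      using b that by auto
    ultimately show "?Q b"
      using b l by (force simp: row_def)
  next
    assume Q: "?Q b"
    have "row P (l', m') \<le> row P b" if "(l', m') \<in> col s" for l' m'
      using that Q level_range[of l'] by (auto simp: row_def)
    then show "?top b"
      using Q by auto
  qed
  let ?D = "filter ?Q (map fst (down s))"
  have "distinct ?D"
    using down_distinct by simp
  then have "length ?D = card (set ?D)"
    by (rule distinct_card[symmetric])
  also have "set ?D = {b. b \<in> fst ` set (down s) \<and> ?Q b}"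
    by auto
  also have "\<dots> = {b. free_block P (col s) b \<and> ?top b}"
  proof -
    have "b \<in> fst ` set (down s) \<longleftrightarrow> (\<exists>t n. (b, t, n) \<in> set (down s))" for b
      by (metis (no_types, opaque_lifting) fst_conv image_iff surj_pair)
    then show ?thesis
      unfolding top free_col_iff by blast
  qed
  finally have card: "length ?D = card {b. free_block P (col s) b \<and> ?top b}" .
  have "(\<exists>!b. free_block P (col s) b \<and> ?top b) \<longleftrightarrow> card {b. free_block P (col s) b \<and> ?top b} = 1"
    unfolding is_singleton_altdef[symmetric] is_singleton_def Ex1_def by (simp add: set_eq_iff) blast
  also have "\<dots> \<longleftrightarrow> length (filter (\<lambda>(b, _). ?Q b) (down s)) = 1"
    unfolding card[symmetric] by (simp add: filter_map o_def case_prod_unfold)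
  finally have "(\<exists>!b. free_block P (col s) b \<and> ?top b) \<longleftrightarrow>
      length (filter (\<lambda>(b, _). ?Q b) (down s)) = 1" .
  moreover have "(\<exists>b. free_block P (col s) b \<and> colour P b = 1) \<longleftrightarrow>
      (\<exists>(b, _)\<in>set (down s). colour P b = 1)"
    by (force simp: free_col_iff)
  ultimately show ?thesis
    using exc[of s] pre_young[of s] unfolding exceptional_def by argo
qed

lemma young_col [simp]: "young_column P (col s) \<longleftrightarrow> s \<noteq> exc"
  using pre_young exceptional_col by (simp add: young_column_def)

lemma young_classification:
  assumes "young_column P y"
  obtains s n where "y = shift n (col s)" "s \<noteq> exc"
  using assms classification[of y] young_shift young_col by (metis young_column_def)

section \<open>Crystal operators on classes, read off from the table\<close>

lemma annihilated_col:
  "annihilated P i (shift n (col s)) \<longleftrightarrow> (\<exists>(j, t)\<in>set specials. j \<noteq> i \<and> t = s)"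
proof
  assume "annihilated P i (shift n (col s))"
  then obtain j c where "special P j = Some c" "j \<noteq> i" "shift n (col s) \<in> column_class P c"
    unfolding annihilated_def by blast
  moreover from this obtain t k where "(j, t) \<in> set specials" "c = shift k (col t)"
    using special_Some by blast
  ultimately show "\<exists>(j, t)\<in>set specials. j \<noteq> i \<and> t = s"
    by (auto simp: mem_column_class dest!: shift_col_inj)
next
  assume "\<exists>(j, t)\<in>set specials. j \<noteq> i \<and> t = s"
  then obtain j where j: "(j, s) \<in> set specials" "j \<noteq> i"
    by auto
  then obtain k where "special P j = Some (shift k (col s))" "s \<noteq> exc"
    using specials by blast
  then show "annihilated P i (shift n (col s))"
    using j unfolding annihilated_def by (fastforce simp: mem_column_class)
qed

lemma addable_col_eq:
  "addable P i (col s) = {b. \<exists>t k. (b, t, k) \<in> set (up s) \<and> colour P b = i \<and> t \<noteq> exc}"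
proof -
  have "b \<in> addable P i (col s) \<longleftrightarrow>
      (\<exists>t k. (b, t, k) \<in> set (up s) \<and> colour P b = i \<and> t \<noteq> exc)" for b
  proof
    assume b: "b \<in> addable P i (col s)"
    then have "pre_young_column P (insert b (col s))" "b \<notin> col s"
      by (simp_all add: addable_def young_column_def)
    then have "rests_on P b \<subseteq> col s"
      using pre_young_insert_iff pre_young by blast
    then obtain t k where "(b, t, k) \<in> set (up s)"
      using \<open>b \<notin> col s\<close> addable_col by (metis surj_pair)
    then show "\<exists>t k. (b, t, k) \<in> set (up s) \<and> colour P b = i \<and> t \<noteq> exc"
      using b up_sound[of b t k s] by (auto simp: addable_def)
  next
    assume "\<exists>t k. (b, t, k) \<in> set (up s) \<and> colour P b = i \<and> t \<noteq> exc"
    then show "b \<in> addable P i (col s)"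
      using up_sound[of b _ _ s] by (auto simp: addable_def)
  qed
  then show ?thesis
    by blast
qed

lemma removable_col_eq:
  "removable P i (col s) = {b. \<exists>t k. (b, t, k) \<in> set (down s) \<and> colour P b = i \<and> t \<noteq> exc}"
proof -
  have "b \<in> removable P i (col s) \<longleftrightarrow>
      (\<exists>t k. (b, t, k) \<in> set (down s) \<and> colour P b = i \<and> t \<noteq> exc)" for b
  proof
    assume b: "b \<in> removable P i (col s)"
    then have "free_block P (col s) b"
      by (simp add: free_block_def removable_def young_column_def)
    then obtain t k where "(b, t, k) \<in> set (down s)"
      using free_col_iff by blast
    then show "\<exists>t k. (b, t, k) \<in> set (down s) \<and> colour P b = i \<and> t \<noteq> exc"
      using b down_sound[of "fst b" "snd b" t k s] by (auto simp: removable_def)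
  next
    assume "\<exists>t k. (b, t, k) \<in> set (down s) \<and> colour P b = i \<and> t \<noteq> exc"
    then show "b \<in> removable P i (col s)"
      using down_sound[of "fst b" "snd b" _ _ s] by (auto simp: removable_def)
  qed
  then show ?thesis
    by blast
qed

lemma f_target:
  assumes "s \<noteq> exc" "i \<in> colours" "f s ! i = Some t"
  shows "t \<noteq> exc"
  using f_ok[OF assms(1,2)] assms(3) by (auto simp: arrow_ok_def split: if_splits)

lemma e_target:
  assumes "s \<noteq> exc" "i \<in> colours" "e s ! i = Some t"
  shows "t \<noteq> exc"
  using e_ok[OF assms(1,2)] assms(3) by (auto simp: arrow_ok_def split: if_splits)

text \<open>Addable blocks move along with a shift and rows change by a constant, so the chosen
  block moves too. The result is a shift of the column of the target state, and its class no longer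
  depends on \<open>n\<close>.\<close>

lemma f_col_eq:
  assumes s: "s \<noteq> exc" "i \<in> colours"
  shows "map_option (column_class P) (f_col P i (shift n (col s))) = map_option cls (f s ! i)"
proof (cases "annihilated P i (shift n (col s))")
  case True
  then have "f s ! i = None"
    using f_ok[OF s] unfolding annihilated_col by (simp add: arrow_ok_def)
  then show ?thesis
    using True by (simp add: f_col_def)
next
  case False
  note not_special = this[unfolded annihilated_col]
  show ?thesis
  proof (cases "f s ! i")
    case None
    then have "\<forall>(b, t, k)\<in>set (up s). colour P b = i \<longrightarrow> t = exc"
      using f_ok[OF s] not_special by (simp add: arrow_ok_def)
    then have "addable P i (col s) = {}"
      unfolding addable_col_eq by blast
    then have "addable P i (shift n (col s)) = {}"
      unfolding addable_shift by (simp add: shift_def)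
    then show ?thesis
      using None by (simp add: f_col_def)
  next
    case (Some t)
    then have arrow: "t \<noteq> exc" "\<exists>(b, t', k)\<in>set (up s). t' = t \<and> colour P b = i \<and>
        (\<forall>(b', t'', k')\<in>set (up s).
           colour P b' = i \<longrightarrow> t'' = exc \<or> b' = b \<or> row P b' < row P b)"
      using f_ok[OF s] not_special by (simp_all add: arrow_ok_def)
    from arrow(2) obtain l m k
      where b: "((l, m), t, k) \<in> set (up s)" "letter_colour P l = i" "t \<noteq> exc"
        and all: "\<forall>(b', t'', k')\<in>set (up s).
          colour P b' = i \<longrightarrow> t'' = exc \<or> b' = (l, m) \<or> row P b' < row P (l, m)"
      using arrow(1) by (elim bexE) (auto simp only: split_paired_all prod.case colour_simp)
    have max: "b' = (l, m) \<or> row P b' < row P (l, m)"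
      if "(b', t', k') \<in> set (up s)" "colour P b' = i" "t' \<noteq> exc" for b' t' k'
      using bspec[OF all that(1)] that(2,3) by simp
    let ?A = "addable P i (shift n (col s))"
    have mem: "(l, m + n) \<in> ?A"
      using b by (auto simp: addable_shift addable_col_eq)
    have "b' = (l, m + n) \<or> row P b' < row P (l, m + n)" if b': "b' \<in> ?A" for b'
    proof -
      obtain l' m' where lm': "b' = (l', m' + n)"
        by (metis surj_pair diff_add_cancel)
      then have "(l', m') \<in> addable P i (col s)"
        using b' by (simp add: addable_shift)
      then show ?thesis
        using max[of "(l', m')"] by (auto simp: addable_col_eq lm')
    qed
    \<comment> \<open>The strict inequality in \<open>arrow_ok\<close> makes the maximiser unique,
      as the choice in \<open>ARG_MAX\<close> demands.\<close>
    then have "(ARG_MAX (row P) b. b \<in> ?A) = (l, m + n)"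
      using mem by (intro arg_max_eqI)
    moreover have "insert (l, m + n) (shift n (col s)) = shift (n + k) (col t)"
      using up_sound[OF b(1)] shift_insert[of n l m "col s"] by simp
    ultimately show ?thesis
      using False mem Some by (auto simp: f_col_def)
  qed
qed

lemma e_col_eq:
  assumes s: "s \<noteq> exc" "i \<in> colours"
  shows "map_option (column_class P) (e_col P i (shift n (col s))) = map_option cls (e s ! i)"
proof (cases "annihilated P i (shift n (col s))")
  case True
  then have "e s ! i = None"
    using e_ok[OF s] unfolding annihilated_col by (simp add: arrow_ok_def)
  then show ?thesis
    using True by (simp add: e_col_def)
next
  case False
  note not_special = this[unfolded annihilated_col]
  show ?thesis
  proof (cases "e s ! i")
    case None
    then have "\<forall>(b, t, k)\<in>set (down s). colour P b = i \<longrightarrow> t = exc"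
      using e_ok[OF s] not_special by (simp add: arrow_ok_def)
    then have "removable P i (col s) = {}"
      unfolding removable_col_eq by blast
    then have "removable P i (shift n (col s)) = {}"
      unfolding removable_shift by (simp add: shift_def)
    then show ?thesis
      using None by (simp add: e_col_def)
  next
    case (Some t)
    then have arrow: "t \<noteq> exc" "\<exists>(b, t', k)\<in>set (down s). t' = t \<and> colour P b = i \<and>
        (\<forall>(b', t'', k')\<in>set (down s).
           colour P b' = i \<longrightarrow> t'' = exc \<or> b' = b \<or> row P b' > row P b)"
      using e_ok[OF s] not_special by (simp_all add: arrow_ok_def)
    from arrow(2) obtain l m k
      where b: "((l, m), t, k) \<in> set (down s)" "letter_colour P l = i" "t \<noteq> exc"
        and all: "\<forall>(b', t'', k')\<in>set (down s).
          colour P b' = i \<longrightarrow> t'' = exc \<or> b' = (l, m) \<or> row P b' > row P (l, m)"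
      using arrow(1) by (elim bexE) (auto simp only: split_paired_all prod.case colour_simp)
    have min: "b' = (l, m) \<or> row P b' > row P (l, m)"
      if "(b', t', k') \<in> set (down s)" "colour P b' = i" "t' \<noteq> exc" for b' t' k'
      using bspec[OF all that(1)] that(2,3) by simp
    let ?A = "removable P i (shift n (col s))"
    have mem: "(l, m + n) \<in> ?A"
      using b by (auto simp: removable_shift removable_col_eq)
    have "b' = (l, m + n) \<or> row P (l, m + n) < row P b'" if b': "b' \<in> ?A" for b'
    proof -
      obtain l' m' where lm': "b' = (l', m' + n)"
        by (metis surj_pair diff_add_cancel)
      then have "(l', m') \<in> removable P i (col s)"
        using b' by (simp add: removable_shift)
      then show ?thesis
        using min[of "(l', m')"] by (auto simp: removable_col_eq lm')
    qed
    then have "(ARG_MIN (row P) b. b \<in> ?A) = (l, m + n)"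
      using mem by (intro arg_min_eqI)
    moreover have "shift n (col s) - {(l, m + n)} = shift (n + k) (col t)"
      using down_sound[OF b(1)] shift_Diff[of n "col s" l m] by simp
    ultimately show ?thesis
      using False mem Some by (auto simp: e_col_def)
  qed
qed

text \<open>A non-exceptional column belongs to its own class. The class is therefore nonempty, and
  the image to which \<open>the_elem\<close> is applied is exactly \<open>{r}\<close>.\<close>

lemma descend_eq:
  assumes "s \<noteq> exc" "\<And>n. map_option (column_class P) (F (shift n (col s))) = r"
  shows "descend P F (cls s) = r"
proof -
  have "col s \<in> cls s"
    using assms(1) by (auto simp: mem_column_class intro: exI[of _ 0])
  moreover have "map_option (column_class P) (F y) = r" if "y \<in> cls s" for y
    using that assms(2) by (auto simp: mem_column_class)
  ultimately have "(\<lambda>y. map_option (column_class P) (F y)) ` cls s = {r}"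
    by blast
  then show ?thesis
    by (simp add: descend_def)
qed

lemma f_cls_eq: "s \<noteq> exc \<Longrightarrow> i \<in> colours \<Longrightarrow> f_cls P i (cls s) = map_option cls (f s ! i)"
  unfolding f_cls_def by (intro descend_eq f_col_eq)

lemma e_cls_eq: "s \<noteq> exc \<Longrightarrow> i \<in> colours \<Longrightarrow> e_cls P i (cls s) = map_option cls (e s ! i)"
  unfolding e_cls_def by (intro descend_eq e_col_eq)

lemma phi_eq: "s \<noteq> exc \<Longrightarrow> i \<in> colours \<Longrightarrow> phi P i (cls s) = phis s ! i"
  unfolding phi_def
  by (rule string_length_eq[where S = "- {exc}" and g = "\<lambda>s. f s ! i"])
    (use f_target in \<open>auto simp: f_cls_eq phi_ok\<close>)

lemma eps_eq: "s \<noteq> exc \<Longrightarrow> i \<in> colours \<Longrightarrow> eps P i (cls s) = epss s ! i"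
  unfolding eps_def
  by (rule string_length_eq[where S = "- {exc}" and g = "\<lambda>s. e s ! i"])
    (use e_target in \<open>auto simp: e_cls_eq eps_ok\<close>)

lemma cls_in: "s \<noteq> exc \<Longrightarrow> cls s \<in> column_classes P"
  by (simp add: column_classes_def column_class_def quotientI)

end

section \<open>Energies\<close>

text \<open>The tensor product rule for raising operators, with the four lists running in parallel
  over the colours; the first colour that acts is used. The comparison is weak here and strict in
  \<open>f_tensor\<close>: raising the first factor increases its \<open>phi\<close> by one, and
  raising the second decreases its \<open>eps\<close> by one.\<close>

fun raise_from ::
    "'s option list \<Rightarrow> nat list \<Rightarrow> 's option list \<Rightarrow> nat list \<Rightarrow> 's \<times> 's \<Rightarrow> ('s \<times> 's) option" where
  "raise_from (x # xs) (p # ps) (y # ys) (q # qs) (a, b) =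
     (if q \<le> p then
        (case x of Some a' \<Rightarrow> Some (a', b) | None \<Rightarrow> raise_from xs ps ys qs (a, b))
      else
        (case y of Some b' \<Rightarrow> Some (a, b') | None \<Rightarrow> raise_from xs ps ys qs (a, b)))"
| "raise_from _ _ _ _ _ = None"

lemma raise_from_Some:
  assumes "raise_from xs ps ys qs (a, b) = Some r"
  shows "\<exists>j<length xs. j < length ps \<and> j < length ys \<and> j < length qs \<and>
    (if qs ! j \<le> ps ! j then \<exists>a'. xs ! j = Some a' \<and> r = (a', b)
     else \<exists>b'. ys ! j = Some b' \<and> r = (a, b'))"
  using assms
proof (induction xs ps ys qs "(a, b)" rule: raise_from.induct)
  case (1 x xs p ps y ys q qs)
  show ?case
  proof (cases "raise_from xs ps ys qs (a, b) = Some r \<and> (if q \<le> p then x = None else y = None)")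
    case True
    then have "\<exists>j<length xs. j < length ps \<and> j < length ys \<and> j < length qs \<and>
      (if qs ! j \<le> ps ! j then \<exists>a'. xs ! j = Some a' \<and> r = (a', b)
       else \<exists>b'. ys ! j = Some b' \<and> r = (a, b'))"
      using "1.hyps" by (auto split: if_splits)
    then obtain j where "j < length xs \<and> j < length ps \<and> j < length ys \<and> j < length qs \<and>
      (if qs ! j \<le> ps ! j then \<exists>a'. xs ! j = Some a' \<and> r = (a', b)
       else \<exists>b'. ys ! j = Some b' \<and> r = (a, b'))"
      by blast
    then show ?thesis
      by (intro exI[of _ "Suc j"]) simp
  next
    case False
    then show ?thesis
      using "1.prems" by (intro exI[of _ 0]) (auto split: if_splits option.splits)
  qed
qed simp_all

definition raise ::
    "('s \<Rightarrow> 's option list) \<Rightarrow> ('s \<Rightarrow> nat list) \<Rightarrow> ('s \<Rightarrow> nat list) \<Rightarrow> 's \<times> 's \<Rightarrow> ('s \<times> 's) option" where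
  "raise e phis epss p =
     raise_from (tl (e (fst p))) (tl (phis (fst p))) (tl (e (snd p))) (tl (epss (snd p))) p"

text \<open>The integer is the energy of the old pair minus that of the new one. It therefore
  carries the sign of the lowering arrow that leads back.\<close>

definition raise_zero ::
    "('s \<Rightarrow> 's option list) \<Rightarrow> ('s \<Rightarrow> nat list) \<Rightarrow> ('s \<Rightarrow> nat list) \<Rightarrow> 's \<times> 's \<Rightarrow>
     (('s \<times> 's) \<times> int) option" where
  "raise_zero e phis epss = (\<lambda>(a, b).
     if hd (epss b) \<le> hd (phis a) then map_option (\<lambda>a'. ((a', b), -1)) (hd (e a))
     else map_option (\<lambda>b'. ((a, b'), 1)) (hd (e b)))"

text \<open>The step \<open>r0\<close> is the one that changes the energy; it also returns the change.\<close>

partial_function (option) climb ::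
    "('p \<Rightarrow> 'p option) \<Rightarrow> ('p \<Rightarrow> ('p \<times> int) option) \<Rightarrow> ('p \<Rightarrow> int option) \<Rightarrow> 'p \<Rightarrow> int option" where
  "climb r r0 known p =
     (case r p of
        Some q \<Rightarrow> climb r r0 known q
      | None \<Rightarrow>
          (case known p of
             Some h \<Rightarrow> Some h
           | None \<Rightarrow>
               (case r0 p of
                  Some (q, d) \<Rightarrow> Option.bind (climb r r0 known q) (\<lambda>h. Some (h + d))
                | None \<Rightarrow> None)))"

declare climb.simps [code]

text \<open>Only indices 0 and 1 are counted; the infinitely many 0-blocks below are accounted for
  by the shift of the column.\<close>

definition zeros :: "'l \<Rightarrow> 'l list \<times> 'l list \<Rightarrow> int" where
  "zeros z r = of_bool (z \<in> set (fst r)) + of_bool (z \<in> set (snd r))"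

text \<open>For \<open>d = -1\<close> the letters of index 1 move to index 0, and those of index 0
  move into the full part. For smaller \<open>d\<close> the whole window does. A positive
  \<open>d\<close> fails, since it would require index 0 of \<open>r'\<close> to be full.\<close>

definition included :: "int \<Rightarrow> 'l list \<times> 'l list \<Rightarrow> 'l list \<times> 'l list \<Rightarrow> bool" where
  "included d r r' \<longleftrightarrow>
     (if d = 0 then set (fst r) \<subseteq> set (fst r') \<and> set (snd r) \<subseteq> set (snd r')
      else if d = -1 then set (snd r) \<subseteq> set (fst r')
      else d < 0)"

text \<open>The number passed to \<open>included\<close> is the relative shift at which the
  properness expression is 0. An energy that is not found makes the check fail.\<close>

definition pair_included ::
    "('s \<times> 's \<Rightarrow> int option) \<Rightarrow> ('s \<Rightarrow> 'l list \<times> 'l list) \<Rightarrow> 'l \<Rightarrow> 's \<Rightarrow> 's \<Rightarrow> 's \<Rightarrow> bool" where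
  "pair_included en rows z exc a b \<longleftrightarrow> b = exc \<or>
     (case en (a, b) of
        None \<Rightarrow> False
      | Some h \<Rightarrow> included (zeros z (rows b) - zeros z (rows a) - h) (rows a) (rows b))"

definition row_included ::
    "('s \<times> 's \<Rightarrow> int option) \<Rightarrow> ('s \<Rightarrow> 'l list \<times> 'l list) \<Rightarrow> 'l \<Rightarrow> 's \<Rightarrow> 's list \<Rightarrow> 's \<Rightarrow> bool" where
  "row_included en rows z exc states a \<longleftrightarrow>
     a = exc \<or> list_all (pair_included en rows z exc a) states"

lemma included_window: "included d r r' \<Longrightarrow> shift d (window r) \<subseteq> window r'"
  by (auto simp: included_def split: if_splits)

section \<open>Energies of pairs and comparison of neighbouring columns\<close>

context column_automaton
begin

text \<open>Since \<open>f\<close> leads from \<open>a'\<close> back to \<open>a\<close>,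
  \<open>phi\<close> of \<open>a'\<close> is one larger than that of \<open>a\<close>. So
  \<open>le\<close> becomes the strict inequality under which lowering acts on the first factor of
  the raised pair, and the defining recurrence applies.\<close>

lemma energy_first:
  assumes H: "energy_function P H" and ab: "a \<noteq> exc" "b \<noteq> exc" and i: "i \<in> colours"
    and a': "e a ! i = Some a'" and le: "epss b ! i \<le> phis a ! i"
  shows "H (cls a, cls b) = H (cls a', cls b) + (if i = 0 then -1 else 0)"
proof -
  have a'_exc: "a' \<noteq> exc" and fa': "f a' ! i = Some a"
    using e_target e_inverse ab i a' by blast+
  have phi: "phi P i (cls a') = Suc (phis a ! i)"
    using phi_eq phi_ok a'_exc i fa' by simp
  have eps: "eps P i (cls b) = epss b ! i"
    using eps_eq ab i by simp
  have "f_tensor P i (cls a', cls b) = Some (cls a, cls b)"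
    using f_cls_eq[OF a'_exc i] fa' phi eps le by (simp add: f_tensor_def)
  then have "H (cls a, cls b) - H (cls a', cls b) =
      (if i \<noteq> 0 then 0 else if phi P 0 (cls a') > eps P 0 (cls b) then -1 else 1)"
    using H cls_in[OF a'_exc] cls_in[OF ab(2)] i unfolding energy_function_def by blast
  then show ?thesis
    using phi eps le by (auto split: if_splits)
qed

text \<open>Here \<open>eps\<close> of \<open>b'\<close> is one smaller than that of
  \<open>b\<close>, so the strict inequality becomes the weak one under which lowering acts on the
  second factor.\<close>

lemma energy_second:
  assumes H: "energy_function P H" and ab: "a \<noteq> exc" "b \<noteq> exc" and i: "i \<in> colours"
    and b': "e b ! i = Some b'" and less: "phis a ! i < epss b ! i"
  shows "H (cls a, cls b) = H (cls a, cls b') + (if i = 0 then 1 else 0)"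
proof -
  have b'_exc: "b' \<noteq> exc" and fb': "f b' ! i = Some b"
    using e_target e_inverse ab i b' by blast+
  have phi: "phi P i (cls a) = phis a ! i"
    using phi_eq ab i by simp
  have eps: "eps P i (cls b') = epss b' ! i" "epss b ! i = Suc (epss b' ! i)"
    using eps_eq eps_ok[OF ab(2) i] b'_exc ab i b' by simp_all
  have "f_tensor P i (cls a, cls b') = Some (cls a, cls b)"
    using f_cls_eq[OF b'_exc i] fb' phi eps less by (simp add: f_tensor_def)
  then have "H (cls a, cls b) - H (cls a, cls b') =
      (if i \<noteq> 0 then 0 else if phi P 0 (cls a) > eps P 0 (cls b') then -1 else 1)"
    using H cls_in[OF b'_exc] cls_in[OF ab(1)] i unfolding energy_function_def by blast
  then show ?thesis
    using phi eps less by (auto split: if_splits)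
qed

lemma energy_raise:
  assumes H: "energy_function P H" and ab: "a \<noteq> exc" "b \<noteq> exc"
    and r: "raise e phis epss (a, b) = Some (a', b')"
  shows "a' \<noteq> exc \<and> b' \<noteq> exc \<and> H (cls a, cls b) = H (cls a', cls b')"
proof -
  obtain j where j: "j < 4"
    and step: "if epss b ! Suc j \<le> phis a ! Suc j then e a ! Suc j = Some a' \<and> b' = b
      else e b ! Suc j = Some b' \<and> a' = a"
    using raise_from_Some[OF r[unfolded raise_def fst_conv snd_conv]]
    by (auto simp: table_length nth_tl split: if_splits)
  \<comment> \<open>The tails drop colour 0, so position \<open>j\<close> in them stands for colour
    \<open>Suc j\<close>.\<close>
  have "Suc j \<in> colours"
    using j by (auto simp: colours_def)
  then show ?thesis
    using step energy_first[OF H ab] energy_second[OF H ab] e_target ab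
    by (auto split: if_splits)
qed

lemma energy_raise_zero:
  assumes H: "energy_function P H" and ab: "a \<noteq> exc" "b \<noteq> exc"
    and r: "raise_zero e phis epss (a, b) = Some ((a', b'), d)"
  shows "a' \<noteq> exc \<and> b' \<noteq> exc \<and> H (cls a, cls b) = H (cls a', cls b') + d"
proof -
  have i: "0 \<in> colours"
    by (simp add: colours_def)
  have hd: "hd (e s) = e s ! 0" "hd (phis s) = phis s ! 0" "hd (epss s) = epss s ! 0" for s
    using table_length[of s] by (auto intro!: hd_conv_nth)
  show ?thesis
    using r energy_first[OF H ab i] energy_second[OF H ab i] e_target[OF _ i] ab
    by (auto simp: raise_zero_def hd split: if_splits)
qed

abbreviation energy where
  "energy known \<equiv> climb (raise e phis epss) (raise_zero e phis epss) known"

text \<open>Each step of \<open>climb\<close> preserves the energy up to the recorded change.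
  Fixpoint induction gives partial correctness, which is enough because a result
  \<open>Some h\<close> is given.\<close>

lemma energy_sound:
  assumes H: "energy_function P H"
    and known: "\<And>a b h. known (a, b) = Some h \<Longrightarrow> H (cls a, cls b) = h"
    and "energy known (a, b) = Some h" "a \<noteq> exc" "b \<noteq> exc"
  shows "H (cls a, cls b) = h"
proof -
  \<comment> \<open>The induction rule treats all arguments of \<open>climb\<close> as variables;
    the equations fix the first three throughout.\<close>
  have "r = raise e phis epss \<Longrightarrow> r0 = raise_zero e phis epss \<Longrightarrow> k = known \<Longrightarrow>
      fst p \<noteq> exc \<Longrightarrow> snd p \<noteq> exc \<Longrightarrow> H (cls (fst p), cls (snd p)) = h"
    if "climb r r0 k p = Some h" for r r0 k p h
    using that
  proof (induction r r0 k p h rule: climb.raw_induct[rotated, consumes 1, case_names step])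
    case (step F r r0 k p h)
    obtain a b where p: "p = (a, b)"
      by force
    show ?case
    proof (cases "r p")
      case (Some q)
      then have q: "raise e phis epss (a, b) = Some (fst q, snd q)" "F r r0 k q = Some h"
        using step.hyps step.prems(1) by (simp_all add: p)
      then show ?thesis
        using step.prems step.IH[of r r0 k q h] energy_raise[OF H _ _ q(1)] by (simp add: p)
    next
      case None
      show ?thesis
      proof (cases "k p")
        case (Some h')
        then have "known (a, b) = Some h"
          using step.hyps step.prems(3) \<open>r p = None\<close> by (simp add: p)
        then show ?thesis
          using known by (simp add: p)
      next
        case None
        then obtain q d h' where q: "r0 p = Some (q, d)" "F r r0 k q = Some h'" "h = h' + d"
          using step.hyps \<open>r p = None\<close> by (auto split: option.splits bind_splits)
        then have "raise_zero e phis epss (a, b) = Some ((fst q, snd q), d)"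
          using step.prems(2) by (simp add: p)
        then show ?thesis
          using step.prems step.IH[OF q(2)] q(3) energy_raise_zero[OF H, of a b "fst q" "snd q" d]
          by (simp add: p)
      qed
    qed
  qed
  from this[OF assms(3)] show ?thesis
    using assms(4,5) by simp
qed

text \<open>Above a level \<open>N\<close> below which both columns are full, each has finitely many
  0-blocks: \<open>q - N\<close> from the full indices of a shift by \<open>q\<close>, and those
  counted by \<open>zeros\<close>. Common blocks cancel, so the two cardinalities of differences
  combine to a difference of these counts.\<close>

lemma zero_count_eq:
  "zero_count P (shift r (col c)) (shift p (col a)) =
    p - r + zeros z (rows a) - zeros z (rows c)"
proof -
  \<comment> \<open>The column shifted by \<open>p\<close> is full below index \<open>p\<close>, the
    one shifted by \<open>r\<close> below \<open>r\<close>.\<close>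
  define N where "N = min p r"
  let ?Z = "\<lambda>y. {m. N \<le> m \<and> (z, m) \<in> y}"
  have Z: "finite (?Z (shift q (col s))) \<and> int (card (?Z (shift q (col s)))) = q - N + zeros z (rows s)"
    if "N \<le> q" for q s
  proof -
    have eq: "?Z (shift q (col s)) = {N..<q} \<union>
        ({m. m = q \<and> z \<in> set (fst (rows s))} \<union> {m. m = q + 1 \<and> z \<in> set (snd (rows s))})"
      using that by auto
    have "card {m. m = k \<and> Q} = of_bool Q" for k :: int and Q
      by (cases Q) auto
    moreover have "finite {m. m = k \<and> Q}" for k :: int and Q
      by simp
    ultimately show ?thesis
      unfolding eq using that by (subst card_Un_disjoint; force simp: card_Un_disjoint zeros_def)
  qed
  have card: "card {b \<in> x - y. colour P b = 0} = card (?Z x - ?Z y)"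
    if "\<And>m. m < N \<Longrightarrow> (z, m) \<in> y" for x y
  proof -
    have "{b \<in> x - y. colour P b = 0} = Pair z ` (?Z x - ?Z y)"
      using that zero_letter by (force simp: not_le[symmetric])
    then show ?thesis
      by (simp add: card_image inj_on_def)
  qed
  let ?g = "shift r (col c)" and ?y = "shift p (col a)"
  have Zg: "finite (?Z ?g)" "int (card (?Z ?g)) = r - N + zeros z (rows c)"
    and Zy: "finite (?Z ?y)" "int (card (?Z ?y)) = p - N + zeros z (rows a)"
    using Z[of r c] Z[of p a] by (auto simp: N_def)
  have "int (card (A - B)) - int (card (B - A)) = int (card A) - int (card B)"
    if "finite A" "finite B" for A B :: "int set"
    using card_Int_Diff[OF that(1), of B] card_Int_Diff[OF that(2), of A] by (simp add: Int_commute)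
  from this[OF Zy(1) Zg(1)] show ?thesis
    unfolding zero_count_def using Zg(2) Zy(2) by (subst (1 2) card) (auto simp: N_def)
qed

text \<open>Energies are certified in two rounds: climbing from the vacuum pair alone justifies the
  table \<open>known\<close>, and \<open>known\<close> then stops the climb from every other pair
  early.\<close>

theorem local_right_block_property:
  assumes known: "\<And>a b h. known (a, b) = Some h \<Longrightarrow>
      a \<noteq> exc \<and> b \<noteq> exc \<and> energy [(vac, vac) \<mapsto> 0] (a, b) = Some h"
    and included: "list_all (row_included (energy known) rows z exc states) states"
    and H: "energy_function P H" and g: "g \<in> vacuum_class P"
    and Y: "Y \<in> proper_young_walls P H g"
    and neq: "H (column_class P (Y (k + 1)), column_class P (Y k))
      + zero_count P g (Y (k + 1)) - zero_count P g (Y k) \<noteq> -1"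
  shows "local_right_block Y k"
proof -
  have "young_column P (Y k)" for k
    using Y by (auto simp: proper_young_walls_def young_wall_def)
  then obtain a p b q where Y1: "Y (k + 1) = shift p (col a)" "a \<noteq> exc"
    and Y0: "Y k = shift q (col b)" "b \<noteq> exc"
    by (metis young_classification)
  \<comment> \<open>The shift \<open>r\<close> of the ground-state column cancels in the difference
    of the two zero counts.\<close>
  obtain r where g_eq: "g = shift r (col vac)"
    using g unfolding vacuum_class_def vac(2) by (auto simp: mem_column_class)
  have "pair_included (energy known) rows z exc a b"
    using included Y1(2) unfolding list_all_iff row_included_def states by blast
  then obtain h where h: "energy known (a, b) = Some h"
    and incl: "included (zeros z (rows b) - zeros z (rows a) - h) (rows a) (rows b)"
    using Y0(2) by (auto simp: pair_included_def split: option.splits)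
  have "H (cls vac, cls vac) = 0"
    using H by (simp add: energy_function_def vacuum_class_def vac(2))
  then have "H (cls a', cls b') = h'" if "[(vac, vac) \<mapsto> 0] (a', b') = Some h'" for a' b' h'
    using that by (simp split: if_splits)
  then have "H (cls a', cls b') = h'" if "known (a', b') = Some h'" for a' b' h'
    using energy_sound[OF H] known[OF that] by blast
  then have "H (cls a, cls b) = h"
    using energy_sound[OF H _ h] Y1(2) Y0(2) by blast
  define v where "v = h + (p + zeros z (rows a)) - (q + zeros z (rows b))"
  have "v = H (column_class P (Y (k + 1)), column_class P (Y k))
      + zero_count P g (Y (k + 1)) - zero_count P g (Y k)"
    unfolding Y1(1) Y0(1) g_eq zero_count_eq v_def using \<open>H (cls a, cls b) = h\<close> by simp
  moreover from this have "v \<le> 0"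
    using Y by (auto simp: proper_young_walls_def)
  ultimately have v: "v = 0 \<or> v \<le> -2"
    using neq by linarith
  \<comment> \<open>Raising the index of the left column by \<open>- v\<close> would make the value
    of the expression 0, so the checked inclusion applies to the relative shift
    \<open>p - q - v\<close>.\<close>
  have sub: "shift (p - q - v) (col a) \<subseteq> col b"
    using included_window[OF incl] by (simp add: v_def algebra_simps)
  show ?thesis
    unfolding local_right_block_def
  proof (intro allI impI)
    fix bl assume bl: "bl \<in> Y (k + 1)"
    obtain l m where lm: "bl = (l, m)" by force
    have "(l, m - q - v) \<in> shift (p - q - v) (col a)"
      using bl unfolding lm Y1(1) by simp
    then have mem: "(l, m - q - v) \<in> col b"
      using sub by blast
    \<comment> \<open>For \<open>v = 0\<close> this is \<open>mem\<close>. Otherwise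
      \<open>m - q\<close> lies at least two below the index in \<open>mem\<close>, which is the
      distance that \<open>full_below\<close> needs.\<close>
    have "(l, m - q) \<in> col b"
      using v full_below[OF pre_young mem, of "m - q" l] mem by auto
    then show "bl \<in> Y k"
      unfolding lm Y0(1) by simp
  qed
qed

end

section \<open>Type $E_6^{(2)}$\<close>

definition e_letters :: "e_letter list" where
  "e_letters = [Ec, Ea, Eb, Eb', Ea', Ec', Ez, Eb'', Ed]"

lemma e_pattern_simps:
  "level pattern_E6_2 = e_level"
  "letter_colour pattern_E6_2 = e_colour"
  "rests_on pattern_E6_2 = e_rests_on"
  "colour pattern_E6_2 = (\<lambda>b. e_colour (fst b))"
  "row pattern_E6_2 = (\<lambda>b. 4 * snd b + e_level (fst b))"
  by (auto simp: pattern_E6_2_def colour_def row_def)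

lemma set_e_letters: "set e_letters = UNIV"
proof -
  have "l \<in> set e_letters" for l
    by (cases l) (simp_all add: e_letters_def)
  then show ?thesis
    by blast
qed

text \<open>The states are obtained by closing the column of all blocks of negative index under the
  addition of blocks, modulo shifts.\<close>

datatype e_state =
  E0 | E1 | E2 | E3 | E4 | E5 | E6 | E7 | E8 | E9 | E10 | E11 | E12 | E13 | E14 | E15 | E16 | E17
  | E18 | E19 | E20 | E21 | E22 | E23 | E24 | E25 | E26 | E27

definition e_states :: "e_state list" where
  "e_states = [
     E0, E1, E2, E3, E4, E5, E6, E7, E8, E9, E10, E11, E12, E13, E14, E15, E16, E17, E18, E19,
     E20, E21, E22, E23, E24, E25, E26, E27]"

primrec e_rows :: "e_state \<Rightarrow> e_letter list \<times> e_letter list" where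
  "e_rows E0 = ([], [])"
| "e_rows E1 = ([Ec], [])"
| "e_rows E2 = ([Ea], [])"
| "e_rows E3 = ([Ec, Ea], [])"
| "e_rows E4 = ([Ec, Eb], [])"
| "e_rows E5 = ([Ec, Ea, Eb], [])"
| "e_rows E6 = ([Ec, Ea, Eb'], [])"
| "e_rows E7 = ([Ec, Eb, Ea'], [])"
| "e_rows E8 = ([Ec, Ea, Eb, Eb'], [])"
| "e_rows E9 = ([Ec, Ea, Eb, Ea'], [])"
| "e_rows E10 = ([Ec, Eb, Ea', Ez], [])"
| "e_rows E11 = ([Ec, Ea, Eb, Eb', Ea'], [])"
| "e_rows E12 = ([Ec, Ea, Eb, Eb', Ec'], [])"
| "e_rows E13 = ([Ec, Ea, Eb, Ea', Ez], [])"
| "e_rows E14 = ([Ec, Ea, Eb, Eb', Ea', Ec'], [])"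
| "e_rows E15 = ([Ec, Ea, Eb, Eb', Ea', Ez], [])"
| "e_rows E16 = ([Ec, Ea, Eb, Eb', Ec', Ed], [])"
| "e_rows E17 = ([Ec, Ea, Eb, Eb', Ea', Ec', Ez], [])"
| "e_rows E18 = ([Ec, Ea, Eb, Eb', Ea', Ec', Eb''], [])"
| "e_rows E19 = ([Ec, Ea, Eb, Eb', Ea', Ec', Ed], [])"
| "e_rows E20 = ([Ec, Ea, Eb, Eb', Ea', Ec', Ez, Eb''], [])"
| "e_rows E21 = ([Ec, Ea, Eb, Eb', Ea', Ec', Ez, Ed], [])"
| "e_rows E22 = ([Ec, Ea, Eb, Eb', Ea', Ec', Eb'', Ed], [])"
| "e_rows E23 = ([Ec, Ea, Eb, Eb', Ea', Ec', Ez, Eb''], [Ea])"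
| "e_rows E24 = ([Ec, Ea, Eb, Eb', Ea', Ec', Eb'', Ed], [Ec])"
| "e_rows E25 = ([Ec, Ea, Eb, Eb', Ea', Ec', Eb'', Ed], [Ec, Eb])"
| "e_rows E26 = ([Ec, Ea, Eb, Eb', Ea', Ec', Eb'', Ed], [Ec, Eb, Ea'])"
| "e_rows E27 = ([Ec, Ea, Eb, Eb', Ea', Ec', Eb'', Ed], [Ec, Eb, Ea', Ez])"

primrec e_up :: "e_state \<Rightarrow> (e_letter block \<times> e_state \<times> int) list" where
  "e_up E0 = [((Ec, 0), E1, 0), ((Ea, 0), E2, 0)]"
| "e_up E1 = [((Ea, 0), E3, 0), ((Eb, 0), E4, 0)]"
| "e_up E2 = [((Ec, 0), E3, 0)]"
| "e_up E3 = [((Eb, 0), E5, 0), ((Eb', 0), E6, 0)]"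
| "e_up E4 = [((Ea, 0), E5, 0), ((Ea', 0), E7, 0)]"
| "e_up E5 = [((Eb', 0), E8, 0), ((Ea', 0), E9, 0)]"
| "e_up E6 = [((Eb, 0), E8, 0)]"
| "e_up E7 = [((Ea, 0), E9, 0), ((Ez, 0), E10, 0)]"
| "e_up E8 = [((Ea', 0), E11, 0), ((Ec', 0), E12, 0)]"
| "e_up E9 = [((Eb', 0), E11, 0), ((Ez, 0), E13, 0)]"
| "e_up E10 = [((Ea, 0), E13, 0)]"
| "e_up E11 = [((Ec', 0), E14, 0), ((Ez, 0), E15, 0)]"
| "e_up E12 = [((Ea', 0), E14, 0), ((Ed, 0), E16, 0)]"
| "e_up E13 = [((Eb', 0), E15, 0)]"
| "e_up E14 = [((Ez, 0), E17, 0), ((Eb'', 0), E18, 0), ((Ed, 0), E19, 0)]"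
| "e_up E15 = [((Ec', 0), E17, 0)]"
| "e_up E16 = [((Ea', 0), E19, 0)]"
| "e_up E17 = [((Eb'', 0), E20, 0), ((Ed, 0), E21, 0)]"
| "e_up E18 = [((Ez, 0), E20, 0), ((Ed, 0), E22, 0)]"
| "e_up E19 = [((Ez, 0), E21, 0), ((Eb'', 0), E22, 0)]"
| "e_up E20 = [((Ed, 0), E0, 1), ((Ea, 1), E23, 0)]"
| "e_up E21 = [((Eb'', 0), E0, 1)]"
| "e_up E22 = [((Ez, 0), E0, 1), ((Ec, 1), E24, 0)]"
| "e_up E23 = [((Ed, 0), E2, 1)]"
| "e_up E24 = [((Ez, 0), E1, 1), ((Eb, 1), E25, 0)]"
| "e_up E25 = [((Ez, 0), E4, 1), ((Ea', 1), E26, 0)]"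
| "e_up E26 = [((Ez, 0), E7, 1), ((Ez, 1), E27, 0)]"
| "e_up E27 = [((Ez, 0), E10, 1)]"

primrec e_down :: "e_state \<Rightarrow> (e_letter block \<times> e_state \<times> int) list" where
  "e_down E0 = [((Ed, -1), E20, -1), ((Eb'', -1), E21, -1), ((Ez, -1), E22, -1)]"
| "e_down E1 = [((Ec, 0), E0, 0), ((Ez, -1), E24, -1)]"
| "e_down E2 = [((Ea, 0), E0, 0), ((Ed, -1), E23, -1)]"
| "e_down E3 = [((Ea, 0), E1, 0), ((Ec, 0), E2, 0)]"
| "e_down E4 = [((Eb, 0), E1, 0), ((Ez, -1), E25, -1)]"
| "e_down E5 = [((Eb, 0), E3, 0), ((Ea, 0), E4, 0)]"
| "e_down E6 = [((Eb', 0), E3, 0)]"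
| "e_down E7 = [((Ea', 0), E4, 0), ((Ez, -1), E26, -1)]"
| "e_down E8 = [((Eb', 0), E5, 0), ((Eb, 0), E6, 0)]"
| "e_down E9 = [((Ea', 0), E5, 0), ((Ea, 0), E7, 0)]"
| "e_down E10 = [((Ez, 0), E7, 0), ((Ez, -1), E27, -1)]"
| "e_down E11 = [((Ea', 0), E8, 0), ((Eb', 0), E9, 0)]"
| "e_down E12 = [((Ec', 0), E8, 0)]"
| "e_down E13 = [((Ez, 0), E9, 0), ((Ea, 0), E10, 0)]"
| "e_down E14 = [((Ec', 0), E11, 0), ((Ea', 0), E12, 0)]"
| "e_down E15 = [((Ez, 0), E11, 0), ((Eb', 0), E13, 0)]"
| "e_down E16 = [((Ed, 0), E12, 0)]"
| "e_down E17 = [((Ez, 0), E14, 0), ((Ec', 0), E15, 0)]"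
| "e_down E18 = [((Eb'', 0), E14, 0)]"
| "e_down E19 = [((Ed, 0), E14, 0), ((Ea', 0), E16, 0)]"
| "e_down E20 = [((Eb'', 0), E17, 0), ((Ez, 0), E18, 0)]"
| "e_down E21 = [((Ed, 0), E17, 0), ((Ez, 0), E19, 0)]"
| "e_down E22 = [((Ed, 0), E18, 0), ((Eb'', 0), E19, 0)]"
| "e_down E23 = [((Ea, 1), E20, 0)]"
| "e_down E24 = [((Ec, 1), E22, 0)]"
| "e_down E25 = [((Eb, 1), E24, 0)]"
| "e_down E26 = [((Ea', 1), E25, 0)]"
| "e_down E27 = [((Ez, 1), E26, 0)]"

text \<open>The arrows differ from \<open>e_up\<close> in three ways. Moves into the exceptional
  state \<open>E5\<close> are dropped, so \<open>E3\<close> goes to \<open>E6\<close> with colour 2.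
  Of two addable blocks the higher is taken, as at \<open>E26\<close>. The special states
  \<open>E7\<close> and \<open>E6\<close> keep only colours 1 and 2, so \<open>E7\<close> has no
  0-arrow to \<open>E10\<close>.\<close>

primrec e_f :: "e_state \<Rightarrow> e_state option list" where
  "e_f E0 = [None, Some E2, None, Some E1, None]"
| "e_f E1 = [None, Some E3, Some E4, None, None]"
| "e_f E2 = [None, None, None, Some E3, None]"
| "e_f E3 = [None, None, Some E6, None, None]"
| "e_f E4 = [None, Some E7, None, None, None]"
| "e_f E5 = [None, None, None, None, None]"
| "e_f E6 = [None, None, Some E8, None, None]"
| "e_f E7 = [None, Some E9, None, None, None]"
| "e_f E8 = [None, Some E11, None, Some E12, None]"
| "e_f E9 = [Some E13, None, Some E11, None, None]"
| "e_f E10 = [None, Some E13, None, None, None]"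
| "e_f E11 = [Some E15, None, None, Some E14, None]"
| "e_f E12 = [None, Some E14, None, None, Some E16]"
| "e_f E13 = [None, None, Some E15, None, None]"
| "e_f E14 = [Some E17, None, Some E18, None, Some E19]"
| "e_f E15 = [None, None, None, Some E17, None]"
| "e_f E16 = [None, Some E19, None, None, None]"
| "e_f E17 = [None, None, Some E20, None, Some E21]"
| "e_f E18 = [Some E20, None, None, None, Some E22]"
| "e_f E19 = [Some E21, None, Some E22, None, None]"
| "e_f E20 = [None, Some E23, None, None, Some E0]"
| "e_f E21 = [None, None, Some E0, None, None]"
| "e_f E22 = [Some E0, None, None, Some E24, None]"
| "e_f E23 = [None, None, None, None, Some E2]"
| "e_f E24 = [Some E1, None, Some E25, None, None]"
| "e_f E25 = [Some E4, Some E26, None, None, None]"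
| "e_f E26 = [Some E27, None, None, None, None]"
| "e_f E27 = [Some E10, None, None, None, None]"

primrec e_e :: "e_state \<Rightarrow> e_state option list" where
  "e_e E0 = [Some E22, None, Some E21, None, Some E20]"
| "e_e E1 = [Some E24, None, None, Some E0, None]"
| "e_e E2 = [None, Some E0, None, None, Some E23]"
| "e_e E3 = [None, Some E1, None, Some E2, None]"
| "e_e E4 = [Some E25, None, Some E1, None, None]"
| "e_e E5 = [None, None, None, None, None]"
| "e_e E6 = [None, None, Some E3, None, None]"
| "e_e E7 = [None, Some E4, None, None, None]"
| "e_e E8 = [None, None, Some E6, None, None]"
| "e_e E9 = [None, Some E7, None, None, None]"
| "e_e E10 = [Some E27, None, None, None, None]"
| "e_e E11 = [None, Some E8, Some E9, None, None]"
| "e_e E12 = [None, None, None, Some E8, None]"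
| "e_e E13 = [Some E9, Some E10, None, None, None]"
| "e_e E14 = [None, Some E12, None, Some E11, None]"
| "e_e E15 = [Some E11, None, Some E13, None, None]"
| "e_e E16 = [None, None, None, None, Some E12]"
| "e_e E17 = [Some E14, None, None, Some E15, None]"
| "e_e E18 = [None, None, Some E14, None, None]"
| "e_e E19 = [None, Some E16, None, None, Some E14]"
| "e_e E20 = [Some E18, None, Some E17, None, None]"
| "e_e E21 = [Some E19, None, None, None, Some E17]"
| "e_e E22 = [None, None, Some E19, None, Some E18]"
| "e_e E23 = [None, Some E20, None, None, None]"
| "e_e E24 = [None, None, None, Some E22, None]"
| "e_e E25 = [None, None, Some E24, None, None]"
| "e_e E26 = [None, Some E25, None, None, None]"
| "e_e E27 = [Some E26, None, None, None, None]"

primrec e_phis :: "e_state \<Rightarrow> nat list" where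
  "e_phis E0 = [0, 1, 0, 1, 0]"
| "e_phis E1 = [0, 1, 1, 0, 0]"
| "e_phis E2 = [0, 0, 0, 1, 0]"
| "e_phis E3 = [0, 0, 2, 0, 0]"
| "e_phis E4 = [0, 2, 0, 0, 0]"
| "e_phis E5 = [0, 0, 0, 0, 0]"
| "e_phis E6 = [0, 0, 1, 0, 0]"
| "e_phis E7 = [0, 1, 0, 0, 0]"
| "e_phis E8 = [0, 1, 0, 1, 0]"
| "e_phis E9 = [1, 0, 1, 0, 0]"
| "e_phis E10 = [0, 1, 0, 0, 0]"
| "e_phis E11 = [1, 0, 0, 1, 0]"
| "e_phis E12 = [0, 1, 0, 0, 1]"
| "e_phis E13 = [0, 0, 1, 0, 0]"
| "e_phis E14 = [1, 0, 1, 0, 1]"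
| "e_phis E15 = [0, 0, 0, 1, 0]"
| "e_phis E16 = [0, 1, 0, 0, 0]"
| "e_phis E17 = [0, 0, 1, 0, 1]"
| "e_phis E18 = [1, 0, 0, 0, 1]"
| "e_phis E19 = [1, 0, 1, 0, 0]"
| "e_phis E20 = [0, 1, 0, 0, 1]"
| "e_phis E21 = [0, 0, 1, 0, 0]"
| "e_phis E22 = [1, 0, 0, 1, 0]"
| "e_phis E23 = [0, 0, 0, 0, 1]"
| "e_phis E24 = [1, 0, 1, 0, 0]"
| "e_phis E25 = [1, 1, 0, 0, 0]"
| "e_phis E26 = [2, 0, 0, 0, 0]"
| "e_phis E27 = [1, 0, 0, 0, 0]"

primrec e_epss :: "e_state \<Rightarrow> nat list" where
  "e_epss E0 = [1, 0, 1, 0, 1]"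
| "e_epss E1 = [1, 0, 0, 1, 0]"
| "e_epss E2 = [0, 1, 0, 0, 1]"
| "e_epss E3 = [0, 1, 0, 1, 0]"
| "e_epss E4 = [1, 0, 1, 0, 0]"
| "e_epss E5 = [0, 0, 0, 0, 0]"
| "e_epss E6 = [0, 0, 1, 0, 0]"
| "e_epss E7 = [0, 1, 0, 0, 0]"
| "e_epss E8 = [0, 0, 2, 0, 0]"
| "e_epss E9 = [0, 2, 0, 0, 0]"
| "e_epss E10 = [2, 0, 0, 0, 0]"
| "e_epss E11 = [0, 1, 1, 0, 0]"
| "e_epss E12 = [0, 0, 0, 1, 0]"
| "e_epss E13 = [1, 1, 0, 0, 0]"
| "e_epss E14 = [0, 1, 0, 1, 0]"
| "e_epss E15 = [1, 0, 1, 0, 0]"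
| "e_epss E16 = [0, 0, 0, 0, 1]"
| "e_epss E17 = [1, 0, 0, 1, 0]"
| "e_epss E18 = [0, 0, 1, 0, 0]"
| "e_epss E19 = [0, 1, 0, 0, 1]"
| "e_epss E20 = [1, 0, 1, 0, 0]"
| "e_epss E21 = [1, 0, 0, 0, 1]"
| "e_epss E22 = [0, 0, 1, 0, 1]"
| "e_epss E23 = [0, 1, 0, 0, 0]"
| "e_epss E24 = [0, 0, 0, 1, 0]"
| "e_epss E25 = [0, 0, 1, 0, 0]"
| "e_epss E26 = [0, 1, 0, 0, 0]"
| "e_epss E27 = [1, 0, 0, 0, 0]"

definition e_specials :: "(nat \<times> e_state) list" where
  "e_specials = [(1, E7), (2, E6)]"

section \<open>Verification of the tables by evaluation\<close>

lemma set_e_states: "set e_states = UNIV"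
proof -
  have "s \<in> set e_states" for s
    by (cases s) (simp_all add: e_states_def)
  then show ?thesis
    by blast
qed

lemma e_rows_distinct: "distinct (map e_rows e_states)"
  by code_simp

lemma e_rows_check: "\<forall>s\<in>set e_states.
      filter (\<lambda>l. l \<in> set (fst (e_rows s))) e_letters = fst (e_rows s) \<and>
      filter (\<lambda>l. l \<in> set (snd (e_rows s))) e_letters = snd (e_rows s) \<and>
      (\<exists>l\<in>set e_letters. l \<notin> set (fst (e_rows s)))"
  by code_simp

lemma e_empty_check: "\<exists>s\<in>set e_states. e_rows s = ([], [])"
  by code_simp

lemma e_pre_young_check: "\<forall>s\<in>set e_states.
      (\<forall>l\<in>set (fst (e_rows s)). \<forall>c\<in>e_rests_on (l, 0). in_window (e_rows s) c) \<and>
      (\<forall>l\<in>set (snd (e_rows s)). \<forall>c\<in>e_rests_on (l, 1). in_window (e_rows s) c)"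
  by code_simp

lemma e_up_complete_check: "\<forall>s\<in>set e_states. \<forall>m\<in>set [0, 1, 2]. \<forall>l\<in>set e_letters.
      in_window (e_rows s) (l, m) \<or> (\<exists>c\<in>e_rests_on (l, m). \<not> in_window (e_rows s) c) \<or>
      (l, m) \<in> set (map fst (e_up s))"
  by code_simp

lemma e_up_sound_check: "\<forall>s\<in>set e_states. \<forall>(b, t, n)\<in>set (e_up s).
      0 \<le> n \<and> n \<le> 1 \<and> 0 \<le> snd b \<and> snd b \<le> 2 \<and> \<not> in_window (e_rows s) b \<and>
      (\<forall>m\<in>set [0, 1, 2]. \<forall>l\<in>set e_letters.
        (l, m) = b \<or> in_window (e_rows s) (l, m) \<longleftrightarrow> in_window (e_rows t) (l, m - n))"
  by code_simp

lemma e_up_down_check: "\<forall>s\<in>set e_states. \<forall>(b, t, n)\<in>set (e_up s).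
      ((fst b, snd b - n), s, - n) \<in> set (e_down t)"
  by code_simp

lemma e_down_up_check: "\<forall>s\<in>set e_states. \<forall>(b, t, n)\<in>set (e_down s).
      ((fst b, snd b - n), s, - n) \<in> set (e_up t)"
  by code_simp

lemma e_exc_check: "\<forall>s\<in>set e_states.
      (\<exists>(b, _)\<in>set (e_down s). e_colour (fst b) = 1) \<and>
      length (filter (\<lambda>(b, _). e_colour (fst b) = 2 \<and> -1 \<le> 4 * snd b + e_level (fst b) \<and>
        (\<forall>l\<in>set (fst (e_rows s)). e_level l \<le> 4 * snd b + e_level (fst b)) \<and>
        (\<forall>l\<in>set (snd (e_rows s)). e_level l + 4 \<le> 4 * snd b + e_level (fst b)))
        (e_down s)) = 1 \<longleftrightarrow>
      s = E5"
  by code_simp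

lemma e_down_distinct_check: "\<forall>s\<in>set e_states. distinct (map fst (e_down s))"
  by code_simp

lemma e_table_check: "\<forall>s\<in>set e_states.
      length (e_e s) = 5 \<and> length (e_phis s) = 5 \<and> length (e_epss s) = 5 \<and>
      (s \<noteq> E5 \<longrightarrow> (\<forall>i\<in>colours.
        arrow_ok (<) (\<lambda>b. e_colour (fst b)) (\<lambda>b. 4 * snd b + e_level (fst b))
          e_specials E5 i s (e_up s) (e_f s ! i) \<and>
        arrow_ok (>) (\<lambda>b. e_colour (fst b)) (\<lambda>b. 4 * snd b + e_level (fst b))
          e_specials E5 i s (e_down s) (e_e s ! i) \<and>
        (case e_e s ! i of None \<Rightarrow> e_epss s ! i = 0
          | Some t \<Rightarrow> e_epss s ! i = Suc (e_epss t ! i) \<and> e_f t ! i = Some s) \<and>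
        (case e_f s ! i of None \<Rightarrow> e_phis s ! i = 0
          | Some t \<Rightarrow> e_phis s ! i = Suc (e_phis t ! i))))"
  by code_simp

text \<open>From any block of index k one gets down to \<open>Eb''\<close> of index k - 1, which
  forces \<open>Ea\<close> and \<open>Ec\<close> of index k - 1, and these two force everything of
  index k - 2. The distance 2 is sharp: in \<open>E23\<close> a block of index 1 is present while
  \<open>Ed\<close> of index 0 is missing.\<close>

lemma e_full_below:
  assumes y: "pre_young_column pattern_E6_2 y" and "(l, m) \<in> y" "m' \<le> m - 2"
  shows "(l', m') \<in> y"
proof -
  have rests: "e_rests_on b \<subseteq> y" if "b \<in> y" for b
    using y that by (simp add: pre_young_column_def e_pattern_simps)
  have down: "(Ec, k) \<in> y \<Longrightarrow> (Eb'', k - 1) \<in> y \<and> (Ed, k - 1) \<in> y"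
    "(Ea, k) \<in> y \<Longrightarrow> (Ez, k - 1) \<in> y \<and> (Eb'', k - 1) \<in> y"
    "(Eb, k) \<in> y \<Longrightarrow> (Ec, k) \<in> y"
    "(Eb', k) \<in> y \<Longrightarrow> (Ec, k) \<in> y \<and> (Ea, k) \<in> y"
    "(Ea', k) \<in> y \<Longrightarrow> (Eb, k) \<in> y"
    "(Ec', k) \<in> y \<Longrightarrow> (Eb, k) \<in> y \<and> (Eb', k) \<in> y"
    "(Ez, k) \<in> y \<Longrightarrow> (Ea', k) \<in> y"
    "(Eb'', k) \<in> y \<Longrightarrow> (Ea', k) \<in> y \<and> (Ec', k) \<in> y"
    "(Ed, k) \<in> y \<Longrightarrow> (Ec', k) \<in> y" for k
    using rests[of "(Ec, k)"]
      rests[of "(Ea, k)"]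
      rests[of "(Eb, k)"]
      rests[of "(Eb', k)"]
      rests[of "(Ea', k)"]
      rests[of "(Ec', k)"]
      rests[of "(Ez, k)"]
      rests[of "(Eb'', k)"]
      rests[of "(Ed, k)"]
    by simp_all
  have hub: "(Eb'', k - 1) \<in> y" if "(l, k) \<in> y" for l k
    using that down[of k] down[of "k - 1"] by (cases l) simp_all
  have below: "(Ea, k) \<in> y \<and> (Ec, k) \<in> y" if "(Eb'', k) \<in> y" for k
    using that down[of k] by simp
  have all: "(l, k - 1) \<in> y" if "(Ea, k) \<in> y \<and> (Ec, k) \<in> y" for l k
    using that down[of k] down[of "k - 1"] by (cases l) simp_all
  have "\<forall>l'. (l', m') \<in> y"
    using assms(3)
  proof (induction m' rule: int_le_induct)
    case base
    show ?case
      using all[OF below[OF hub[OF assms(2)]]] by simp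
  next
    case (step k)
    then show ?case
      using all by blast
  qed
  then show ?thesis
    by blast
qed

text \<open>Every block rests on strictly lower rows in this type, so \<open>e_level\<close> itself
  serves as height.\<close>

lemma e_periodic: "periodic_pattern pattern_E6_2 e_level Ez"
proof (unfold_locales, unfold e_pattern_simps)
  show "finite (UNIV :: e_letter set)"
    using finite_set[of e_letters] by (simp add: set_e_letters)
  show "0 \<le> e_level l" "e_level l \<le> 3" for l
    by (cases l; simp)+
  show "\<exists>l. e_level l = 3"
    by (rule exI[of _ Ez]) simp
  show "e_colour l = 0 \<longleftrightarrow> l = Ez" for l
    by (cases l) simp_all
  show "e_rests_on (l, m + n) = shift n (e_rests_on (l, m))" for l m n
    by (cases l) (auto simp: shift_def)
  show "e_rests_on b \<noteq> {}" for b
    by (cases b rule: e_rests_on.cases) auto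
  show "snd c = snd b \<or> snd c = snd b - 1" if "c \<in> e_rests_on b" for b c
    using that by (cases b rule: e_rests_on.cases) auto
  show "5 * snd c + e_level (fst c) < 5 * snd b + e_level (fst b)" if "c \<in> e_rests_on b" for b c
    using that by (cases b rule: e_rests_on.cases) (auto)
qed (rule e_full_below)

lemma e_vacuum: "vacuum pattern_E6_2 = window (e_rows E27)"
proof (intro set_eqI, unfold split_paired_all)
  show "(l, m) \<in> vacuum pattern_E6_2 \<longleftrightarrow> (l, m) \<in> window (e_rows E27)" for l m
    by (cases l) (auto simp: pattern_E6_2_def e_base_def)
qed

text \<open>Adding \<open>Ez\<close> and \<open>Ed\<close> to the base fills index 0, so the normal
  form lies one index lower. The vacuum column lacks \<open>Ez\<close> at index 0 and is already
  normal.\<close>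

lemma e_special_1:
  "e_base \<union> {(Ez, 0), (Ed, 0), (Ec, 1), (Eb, 1), (Ea', 1)} =
    shift 1 (window (e_rows E7))" (is "?x = ?y")
proof (intro set_eqI, unfold split_paired_all)
  show "(l, m) \<in> ?x \<longleftrightarrow> (l, m) \<in> ?y" for l m
    by (cases l) (auto simp: e_base_def)
qed

lemma e_special_2:
  "e_base \<union> {(Ez, 0), (Ea, 1), (Eb', 1), (Ed, 0), (Ec, 1)} =
    shift 1 (window (e_rows E6))" (is "?x = ?y")
proof (intro set_eqI, unfold split_paired_all)
  show "(l, m) \<in> ?x \<longleftrightarrow> (l, m) \<in> ?y" for l m
    by (cases l) (auto simp: e_base_def)
qed

lemma e_special:
  "special pattern_E6_2 j =
    map_option (\<lambda>t. shift 1 (window (e_rows t))) (map_of e_specials j)"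
  unfolding pattern_E6_2_def e_specials_def e_special_1 e_special_2 by simp

lemma e_special_Some:
  assumes "special pattern_E6_2 j = Some c"
  shows "\<exists>t k. (j, t) \<in> set e_specials \<and> c = shift k (window (e_rows t))"
  using assms unfolding e_special by (auto dest: map_of_SomeD)

lemma e_specials:
  assumes "(j, t) \<in> set e_specials"
  shows "t \<noteq> E5 \<and> (\<exists>k. special pattern_E6_2 j = Some (shift k (window (e_rows t))))"
  using assms unfolding e_special by (auto simp: e_specials_def)

section \<open>Energies and inclusions in type E_6^(2)\<close>

interpretation E6: column_automaton pattern_E6_2 e_level Ez e_letters e_states e_rows e_up
  e_down E5 E27 e_specials e_f e_e e_phis e_epss
proof (intro column_automaton.intro column_automaton_axioms.intro e_periodic,
    unfold e_pattern_simps)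
  show "E27 \<noteq> E5"
    by simp
qed (fact set_e_letters set_e_states e_rows_distinct e_rows_check e_empty_check
  e_pre_young_check e_up_complete_check e_up_sound_check e_up_down_check
  e_down_up_check e_exc_check e_down_distinct_check e_vacuum e_special_Some
  e_specials e_table_check)+

text \<open>The pairs at which raising with colours 1 to 4 is stuck: the first factor admits no
  raising, and \<open>eps\<close> of the second is at most \<open>phi\<close> of the first in each
  of these colours. So the first is \<open>E10\<close> or \<open>E27\<close>. For \<open>E27\<close>
  all these \<open>phi\<close> vanish, leaving \<open>E10\<close> and \<open>E27\<close> as second
  factor; for \<open>E10\<close> only \<open>phi\<close> of colour 1 is 1, leaving six.\<close>

definition e_known :: "((e_state \<times> e_state) \<times> int) list" where
  "e_known = [
     ((E10, E7), 0), ((E10, E10), 2), ((E10, E13), 1), ((E10, E23), 0),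
     ((E10, E26), 0), ((E10, E27), 1), ((E27, E10), 1), ((E27, E27), 0)]"

text \<open>Without these constants of function type, \<open>code_simp\<close> would carry the unfolded table through
  every step of \<open>climb\<close>.\<close>

definition e_known_energy :: "e_state \<times> e_state \<Rightarrow> int option" where
  "e_known_energy p = map_of e_known p"

definition e_vacuum_energy :: "e_state \<times> e_state \<Rightarrow> int option" where
  "e_vacuum_energy p = [(E27, E27) \<mapsto> 0] p"

text \<open>As an example, 0-steps lead from \<open>(E10, E10)\<close> through
  \<open>(E10, E27)\<close> and \<open>(E10, E26)\<close> to \<open>(E27, E26)\<close>. Colours 1 to
  4 then lead to \<open>(E27, E10)\<close>, and a last 0-step to the vacuum pair. The changes +1,
  +1, -1, +1 add up to 2.\<close>

lemma e_known_check: "\<forall>((a, b), h)\<in>set e_known. a \<noteq> E5 \<and> b \<noteq> E5 \<and>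
    climb (raise e_e e_phis e_epss) (raise_zero e_e e_phis e_epss) e_vacuum_energy (a, b) = Some h"
  by code_simp

lemma e_included_check:
  "list_all (row_included
    (climb (raise e_e e_phis e_epss) (raise_zero e_e e_phis e_epss) e_known_energy)
    e_rows Ez E5 e_states) e_states"
  by code_simp

theorem e_local_right_block:
  assumes "energy_function pattern_E6_2 H" "g \<in> vacuum_class pattern_E6_2"
    and "Y \<in> proper_young_walls pattern_E6_2 H g"
    and "H (column_class pattern_E6_2 (Y (k + 1)), column_class pattern_E6_2 (Y k))
      + zero_count pattern_E6_2 g (Y (k + 1)) - zero_count pattern_E6_2 g (Y k) \<noteq> -1"
  shows "local_right_block Y k"
proof (rule E6.local_right_block_property[OF _ e_included_check assms])
  fix a b h
  assume "e_known_energy (a, b) = Some h"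
  then have "((a, b), h) \<in> set e_known"
    unfolding e_known_energy_def by (rule map_of_SomeD)
  moreover have "e_vacuum_energy = [(E27, E27) \<mapsto> 0]"
    by (rule ext) (simp add: e_vacuum_energy_def)
  ultimately show "a \<noteq> E5 \<and> b \<noteq> E5 \<and>
      climb (raise e_e e_phis e_epss) (raise_zero e_e e_phis e_epss) [(E27, E27) \<mapsto> 0] (a, b) = Some h"
    using e_known_check by auto
qed

section \<open>Type $F_4^{(1)}$\<close>

definition f_letters :: "f_letter list" where
  "f_letters = [Fc1, Fd1, Fa1, Fc2, Fb1, Fb2, Fc3, Fa2, Fc4, Fd2, Fz, Fb3]"

lemma f_pattern_simps:
  "level pattern_F4_1 = f_level"
  "letter_colour pattern_F4_1 = f_colour"
  "rests_on pattern_F4_1 = f_rests_on"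
  "colour pattern_F4_1 = (\<lambda>b. f_colour (fst b))"
  "row pattern_F4_1 = (\<lambda>b. 4 * snd b + f_level (fst b))"
  by (auto simp: pattern_F4_1_def colour_def row_def)

lemma set_f_letters: "set f_letters = UNIV"
proof -
  have "l \<in> set f_letters" for l
    by (cases l) (simp_all add: f_letters_def)
  then show ?thesis
    by blast
qed

section \<open>States and transition tables in type F_4^(1)\<close>

datatype f_state =
  F0 | F1 | F2 | F3 | F4 | F5 | F6 | F7 | F8 | F9 | F10 | F11 | F12 | F13 | F14 | F15 | F16 | F17
  | F18 | F19 | F20 | F21 | F22 | F23 | F24 | F25 | F26 | F27 | F28 | F29 | F30 | F31 | F32 | F33
  | F34 | F35 | F36 | F37 | F38 | F39 | F40 | F41 | F42 | F43 | F44 | F45 | F46 | F47 | F48 | F49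
  | F50 | F51 | F52 | F53

definition f_states :: "f_state list" where
  "f_states = [
     F0, F1, F2, F3, F4, F5, F6, F7, F8, F9, F10, F11, F12, F13, F14, F15, F16, F17, F18, F19,
     F20, F21, F22, F23, F24, F25, F26, F27, F28, F29, F30, F31, F32, F33, F34, F35, F36, F37,
     F38, F39, F40, F41, F42, F43, F44, F45, F46, F47, F48, F49, F50, F51, F52, F53]"

primrec f_rows :: "f_state \<Rightarrow> f_letter list \<times> f_letter list" where
  "f_rows F0 = ([], [])"
| "f_rows F1 = ([Fc1], [])"
| "f_rows F2 = ([Fd1], [])"
| "f_rows F3 = ([Fa1], [])"
| "f_rows F4 = ([Fc1, Fd1], [])"
| "f_rows F5 = ([Fc1, Fa1], [])"
| "f_rows F6 = ([Fd1, Fa1], [])"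
| "f_rows F7 = ([Fc1, Fd1, Fa1], [])"
| "f_rows F8 = ([Fc1, Fd1, Fc2], [])"
| "f_rows F9 = ([Fc1, Fa1, Fb1], [])"
| "f_rows F10 = ([Fc1, Fd1, Fa1, Fc2], [])"
| "f_rows F11 = ([Fc1, Fd1, Fa1, Fb1], [])"
| "f_rows F12 = ([Fc1, Fd1, Fc2, Fb2], [])"
| "f_rows F13 = ([Fc1, Fa1, Fb1, Fc3], [])"
| "f_rows F14 = ([Fc1, Fd1, Fa1, Fc2, Fb1], [])"
| "f_rows F15 = ([Fc1, Fd1, Fa1, Fc2, Fb2], [])"
| "f_rows F16 = ([Fc1, Fd1, Fa1, Fb1, Fc3], [])"
| "f_rows F17 = ([Fc1, Fd1, Fc2, Fb2, Fa2], [])"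
| "f_rows F18 = ([Fc1, Fa1, Fb1, Fc3, Fd2], [])"
| "f_rows F19 = ([Fc1, Fd1, Fa1, Fc2, Fb1, Fb2], [])"
| "f_rows F20 = ([Fc1, Fd1, Fa1, Fc2, Fb1, Fc3], [])"
| "f_rows F21 = ([Fc1, Fd1, Fa1, Fc2, Fb2, Fa2], [])"
| "f_rows F22 = ([Fc1, Fd1, Fa1, Fb1, Fc3, Fd2], [])"
| "f_rows F23 = ([Fc1, Fd1, Fc2, Fb2, Fa2, Fz], [])"
| "f_rows F24 = ([Fc1, Fd1, Fa1, Fc2, Fb1, Fb2, Fc3], [])"
| "f_rows F25 = ([Fc1, Fd1, Fa1, Fc2, Fb1, Fb2, Fa2], [])"
| "f_rows F26 = ([Fc1, Fd1, Fa1, Fc2, Fb1, Fc3, Fd2], [])"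
| "f_rows F27 = ([Fc1, Fd1, Fa1, Fc2, Fb2, Fa2, Fz], [])"
| "f_rows F28 = ([Fc1, Fd1, Fa1, Fc2, Fb1, Fb2, Fc3, Fa2], [])"
| "f_rows F29 = ([Fc1, Fd1, Fa1, Fc2, Fb1, Fb2, Fc3, Fc4], [])"
| "f_rows F30 = ([Fc1, Fd1, Fa1, Fc2, Fb1, Fb2, Fc3, Fd2], [])"
| "f_rows F31 = ([Fc1, Fd1, Fa1, Fc2, Fb1, Fb2, Fa2, Fz], [])"
| "f_rows F32 = ([Fc1, Fd1, Fa1, Fc2, Fb1, Fb2, Fc3, Fa2, Fc4], [])"
| "f_rows F33 = ([Fc1, Fd1, Fa1, Fc2, Fb1, Fb2, Fc3, Fa2, Fd2], [])"
| "f_rows F34 = ([Fc1, Fd1, Fa1, Fc2, Fb1, Fb2, Fc3, Fa2, Fz], [])"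
| "f_rows F35 = ([Fc1, Fd1, Fa1, Fc2, Fb1, Fb2, Fc3, Fc4, Fd2], [])"
| "f_rows F36 = ([Fc1, Fd1, Fa1, Fc2, Fb1, Fb2, Fc3, Fa2, Fc4, Fd2], [])"
| "f_rows F37 = ([Fc1, Fd1, Fa1, Fc2, Fb1, Fb2, Fc3, Fa2, Fc4, Fz], [])"
| "f_rows F38 = ([Fc1, Fd1, Fa1, Fc2, Fb1, Fb2, Fc3, Fa2, Fc4, Fb3], [])"
| "f_rows F39 = ([Fc1, Fd1, Fa1, Fc2, Fb1, Fb2, Fc3, Fa2, Fd2, Fz], [])"
| "f_rows F40 = ([Fc1, Fd1, Fa1, Fc2, Fb1, Fb2, Fc3, Fc4, Fd2], [Fd1])"
| "f_rows F41 = ([Fc1, Fd1, Fa1, Fc2, Fb1, Fb2, Fc3, Fa2, Fc4, Fd2, Fz], [])"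
| "f_rows F42 = ([Fc1, Fd1, Fa1, Fc2, Fb1, Fb2, Fc3, Fa2, Fc4, Fd2, Fb3], [])"
| "f_rows F43 = ([Fc1, Fd1, Fa1, Fc2, Fb1, Fb2, Fc3, Fa2, Fc4, Fd2], [Fd1])"
| "f_rows F44 = ([Fc1, Fd1, Fa1, Fc2, Fb1, Fb2, Fc3, Fa2, Fc4, Fz, Fb3], [])"
| "f_rows F45 = ([Fc1, Fd1, Fa1, Fc2, Fb1, Fb2, Fc3, Fa2, Fc4, Fd2, Fz], [Fd1])"
| "f_rows F46 = ([Fc1, Fd1, Fa1, Fc2, Fb1, Fb2, Fc3, Fa2, Fc4, Fd2, Fb3], [Fc1])"
| "f_rows F47 = ([Fc1, Fd1, Fa1, Fc2, Fb1, Fb2, Fc3, Fa2, Fc4, Fd2, Fb3], [Fd1])"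
| "f_rows F48 = ([Fc1, Fd1, Fa1, Fc2, Fb1, Fb2, Fc3, Fa2, Fc4, Fz, Fb3], [Fa1])"
| "f_rows F49 = ([Fc1, Fd1, Fa1, Fc2, Fb1, Fb2, Fc3, Fa2, Fc4, Fd2, Fb3], [Fc1, Fd1])"
| "f_rows F50 = ([Fc1, Fd1, Fa1, Fc2, Fb1, Fb2, Fc3, Fa2, Fc4, Fd2, Fb3], [Fc1, Fd1, Fc2])"
| "f_rows F51 = ([Fc1, Fd1, Fa1, Fc2, Fb1, Fb2, Fc3, Fa2, Fc4, Fd2, Fb3], [Fc1, Fd1, Fc2, Fb2])"
| "f_rows F52 = ([Fc1, Fd1, Fa1, Fc2, Fb1, Fb2, Fc3, Fa2, Fc4, Fd2, Fb3], [Fc1, Fd1, Fc2, Fb2, Fa2])"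
| "f_rows F53 = ([Fc1, Fd1, Fa1, Fc2, Fb1, Fb2, Fc3, Fa2, Fc4, Fd2, Fb3], [Fc1, Fd1, Fc2, Fb2, Fa2, Fz])"

primrec f_up :: "f_state \<Rightarrow> (f_letter block \<times> f_state \<times> int) list" where
  "f_up F0 = [((Fc1, 0), F1, 0), ((Fd1, 0), F2, 0), ((Fa1, 0), F3, 0)]"
| "f_up F1 = [((Fd1, 0), F4, 0), ((Fa1, 0), F5, 0)]"
| "f_up F2 = [((Fc1, 0), F4, 0), ((Fa1, 0), F6, 0)]"
| "f_up F3 = [((Fc1, 0), F5, 0), ((Fd1, 0), F6, 0)]"
| "f_up F4 = [((Fa1, 0), F7, 0), ((Fc2, 0), F8, 0)]"
| "f_up F5 = [((Fd1, 0), F7, 0), ((Fb1, 0), F9, 0)]"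
| "f_up F6 = [((Fc1, 0), F7, 0)]"
| "f_up F7 = [((Fc2, 0), F10, 0), ((Fb1, 0), F11, 0)]"
| "f_up F8 = [((Fa1, 0), F10, 0), ((Fb2, 0), F12, 0)]"
| "f_up F9 = [((Fd1, 0), F11, 0), ((Fc3, 0), F13, 0)]"
| "f_up F10 = [((Fb1, 0), F14, 0), ((Fb2, 0), F15, 0)]"
| "f_up F11 = [((Fc2, 0), F14, 0), ((Fc3, 0), F16, 0)]"
| "f_up F12 = [((Fa1, 0), F15, 0), ((Fa2, 0), F17, 0)]"
| "f_up F13 = [((Fd1, 0), F16, 0), ((Fd2, 0), F18, 0)]"
| "f_up F14 = [((Fb2, 0), F19, 0), ((Fc3, 0), F20, 0)]"
| "f_up F15 = [((Fb1, 0), F19, 0), ((Fa2, 0), F21, 0)]"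
| "f_up F16 = [((Fc2, 0), F20, 0), ((Fd2, 0), F22, 0)]"
| "f_up F17 = [((Fa1, 0), F21, 0), ((Fz, 0), F23, 0)]"
| "f_up F18 = [((Fd1, 0), F22, 0)]"
| "f_up F19 = [((Fc3, 0), F24, 0), ((Fa2, 0), F25, 0)]"
| "f_up F20 = [((Fb2, 0), F24, 0), ((Fd2, 0), F26, 0)]"
| "f_up F21 = [((Fb1, 0), F25, 0), ((Fz, 0), F27, 0)]"
| "f_up F22 = [((Fc2, 0), F26, 0)]"
| "f_up F23 = [((Fa1, 0), F27, 0)]"
| "f_up F24 = [((Fa2, 0), F28, 0), ((Fc4, 0), F29, 0), ((Fd2, 0), F30, 0)]"
| "f_up F25 = [((Fc3, 0), F28, 0), ((Fz, 0), F31, 0)]"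
| "f_up F26 = [((Fb2, 0), F30, 0)]"
| "f_up F27 = [((Fb1, 0), F31, 0)]"
| "f_up F28 = [((Fc4, 0), F32, 0), ((Fd2, 0), F33, 0), ((Fz, 0), F34, 0)]"
| "f_up F29 = [((Fa2, 0), F32, 0), ((Fd2, 0), F35, 0)]"
| "f_up F30 = [((Fa2, 0), F33, 0), ((Fc4, 0), F35, 0)]"
| "f_up F31 = [((Fc3, 0), F34, 0)]"
| "f_up F32 = [((Fd2, 0), F36, 0), ((Fz, 0), F37, 0), ((Fb3, 0), F38, 0)]"
| "f_up F33 = [((Fc4, 0), F36, 0), ((Fz, 0), F39, 0)]"
| "f_up F34 = [((Fc4, 0), F37, 0), ((Fd2, 0), F39, 0)]"
| "f_up F35 = [((Fa2, 0), F36, 0), ((Fd1, 1), F40, 0)]"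
| "f_up F36 = [((Fz, 0), F41, 0), ((Fb3, 0), F42, 0), ((Fd1, 1), F43, 0)]"
| "f_up F37 = [((Fd2, 0), F41, 0), ((Fb3, 0), F44, 0)]"
| "f_up F38 = [((Fd2, 0), F42, 0), ((Fz, 0), F44, 0)]"
| "f_up F39 = [((Fc4, 0), F41, 0)]"
| "f_up F40 = [((Fa2, 0), F43, 0)]"
| "f_up F41 = [((Fb3, 0), F0, 1), ((Fd1, 1), F45, 0)]"
| "f_up F42 = [((Fz, 0), F0, 1), ((Fc1, 1), F46, 0), ((Fd1, 1), F47, 0)]"
| "f_up F43 = [((Fz, 0), F45, 0), ((Fb3, 0), F47, 0)]"
| "f_up F44 = [((Fd2, 0), F0, 1), ((Fa1, 1), F48, 0)]"
| "f_up F45 = [((Fb3, 0), F2, 1)]"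
| "f_up F46 = [((Fz, 0), F1, 1), ((Fd1, 1), F49, 0)]"
| "f_up F47 = [((Fz, 0), F2, 1), ((Fc1, 1), F49, 0)]"
| "f_up F48 = [((Fd2, 0), F3, 1)]"
| "f_up F49 = [((Fz, 0), F4, 1), ((Fc2, 1), F50, 0)]"
| "f_up F50 = [((Fz, 0), F8, 1), ((Fb2, 1), F51, 0)]"
| "f_up F51 = [((Fz, 0), F12, 1), ((Fa2, 1), F52, 0)]"
| "f_up F52 = [((Fz, 0), F17, 1), ((Fz, 1), F53, 0)]"
| "f_up F53 = [((Fz, 0), F23, 1)]"

primrec f_down :: "f_state \<Rightarrow> (f_letter block \<times> f_state \<times> int) list" where
  "f_down F0 = [((Fb3, -1), F41, -1), ((Fz, -1), F42, -1), ((Fd2, -1), F44, -1)]"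
| "f_down F1 = [((Fc1, 0), F0, 0), ((Fz, -1), F46, -1)]"
| "f_down F2 = [((Fd1, 0), F0, 0), ((Fb3, -1), F45, -1), ((Fz, -1), F47, -1)]"
| "f_down F3 = [((Fa1, 0), F0, 0), ((Fd2, -1), F48, -1)]"
| "f_down F4 = [((Fd1, 0), F1, 0), ((Fc1, 0), F2, 0), ((Fz, -1), F49, -1)]"
| "f_down F5 = [((Fa1, 0), F1, 0), ((Fc1, 0), F3, 0)]"
| "f_down F6 = [((Fa1, 0), F2, 0), ((Fd1, 0), F3, 0)]"
| "f_down F7 = [((Fa1, 0), F4, 0), ((Fd1, 0), F5, 0), ((Fc1, 0), F6, 0)]"
| "f_down F8 = [((Fc2, 0), F4, 0), ((Fz, -1), F50, -1)]"
| "f_down F9 = [((Fb1, 0), F5, 0)]"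
| "f_down F10 = [((Fc2, 0), F7, 0), ((Fa1, 0), F8, 0)]"
| "f_down F11 = [((Fb1, 0), F7, 0), ((Fd1, 0), F9, 0)]"
| "f_down F12 = [((Fb2, 0), F8, 0), ((Fz, -1), F51, -1)]"
| "f_down F13 = [((Fc3, 0), F9, 0)]"
| "f_down F14 = [((Fb1, 0), F10, 0), ((Fc2, 0), F11, 0)]"
| "f_down F15 = [((Fb2, 0), F10, 0), ((Fa1, 0), F12, 0)]"
| "f_down F16 = [((Fc3, 0), F11, 0), ((Fd1, 0), F13, 0)]"
| "f_down F17 = [((Fa2, 0), F12, 0), ((Fz, -1), F52, -1)]"
| "f_down F18 = [((Fd2, 0), F13, 0)]"
| "f_down F19 = [((Fb2, 0), F14, 0), ((Fb1, 0), F15, 0)]"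
| "f_down F20 = [((Fc3, 0), F14, 0), ((Fc2, 0), F16, 0)]"
| "f_down F21 = [((Fa2, 0), F15, 0), ((Fa1, 0), F17, 0)]"
| "f_down F22 = [((Fd2, 0), F16, 0), ((Fd1, 0), F18, 0)]"
| "f_down F23 = [((Fz, 0), F17, 0), ((Fz, -1), F53, -1)]"
| "f_down F24 = [((Fc3, 0), F19, 0), ((Fb2, 0), F20, 0)]"
| "f_down F25 = [((Fa2, 0), F19, 0), ((Fb1, 0), F21, 0)]"
| "f_down F26 = [((Fd2, 0), F20, 0), ((Fc2, 0), F22, 0)]"
| "f_down F27 = [((Fz, 0), F21, 0), ((Fa1, 0), F23, 0)]"
| "f_down F28 = [((Fa2, 0), F24, 0), ((Fc3, 0), F25, 0)]"
| "f_down F29 = [((Fc4, 0), F24, 0)]"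
| "f_down F30 = [((Fd2, 0), F24, 0), ((Fb2, 0), F26, 0)]"
| "f_down F31 = [((Fz, 0), F25, 0), ((Fb1, 0), F27, 0)]"
| "f_down F32 = [((Fc4, 0), F28, 0), ((Fa2, 0), F29, 0)]"
| "f_down F33 = [((Fd2, 0), F28, 0), ((Fa2, 0), F30, 0)]"
| "f_down F34 = [((Fz, 0), F28, 0), ((Fc3, 0), F31, 0)]"
| "f_down F35 = [((Fd2, 0), F29, 0), ((Fc4, 0), F30, 0)]"
| "f_down F36 = [((Fd2, 0), F32, 0), ((Fc4, 0), F33, 0), ((Fa2, 0), F35, 0)]"
| "f_down F37 = [((Fz, 0), F32, 0), ((Fc4, 0), F34, 0)]"
| "f_down F38 = [((Fb3, 0), F32, 0)]"
| "f_down F39 = [((Fz, 0), F33, 0), ((Fd2, 0), F34, 0)]"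
| "f_down F40 = [((Fd1, 1), F35, 0)]"
| "f_down F41 = [((Fz, 0), F36, 0), ((Fd2, 0), F37, 0), ((Fc4, 0), F39, 0)]"
| "f_down F42 = [((Fb3, 0), F36, 0), ((Fd2, 0), F38, 0)]"
| "f_down F43 = [((Fd1, 1), F36, 0), ((Fa2, 0), F40, 0)]"
| "f_down F44 = [((Fb3, 0), F37, 0), ((Fz, 0), F38, 0)]"
| "f_down F45 = [((Fd1, 1), F41, 0), ((Fz, 0), F43, 0)]"
| "f_down F46 = [((Fc1, 1), F42, 0)]"
| "f_down F47 = [((Fd1, 1), F42, 0), ((Fb3, 0), F43, 0)]"
| "f_down F48 = [((Fa1, 1), F44, 0)]"
| "f_down F49 = [((Fd1, 1), F46, 0), ((Fc1, 1), F47, 0)]"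
| "f_down F50 = [((Fc2, 1), F49, 0)]"
| "f_down F51 = [((Fb2, 1), F50, 0)]"
| "f_down F52 = [((Fa2, 1), F51, 0)]"
| "f_down F53 = [((Fz, 1), F52, 0)]"

text \<open>The exceptional state is \<open>F15\<close>, so \<open>F10\<close> goes to
  \<open>F14\<close> with colour 2. Of the two 3-blocks addable at \<open>F11\<close> the higher is
  taken, leading to \<open>F16\<close>. The special states \<open>F17\<close>, \<open>F14\<close>,
  \<open>F16\<close>, \<open>F18\<close> keep only colours 1, 2, 3, 4 respectively.\<close>

primrec f_f :: "f_state \<Rightarrow> f_state option list" where
  "f_f F0 = [None, Some F3, None, Some F1, Some F2]"
| "f_f F1 = [None, Some F5, None, None, Some F4]"
| "f_f F2 = [None, Some F6, None, Some F4, None]"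
| "f_f F3 = [None, None, None, Some F5, Some F6]"
| "f_f F4 = [None, Some F7, None, Some F8, None]"
| "f_f F5 = [None, None, Some F9, None, Some F7]"
| "f_f F6 = [None, None, None, Some F7, None]"
| "f_f F7 = [None, None, Some F11, Some F10, None]"
| "f_f F8 = [None, Some F10, Some F12, None, None]"
| "f_f F9 = [None, None, None, Some F13, Some F11]"
| "f_f F10 = [None, None, Some F14, None, None]"
| "f_f F11 = [None, None, None, Some F16, None]"
| "f_f F12 = [None, Some F17, None, None, None]"
| "f_f F13 = [None, None, None, None, Some F18]"
| "f_f F14 = [None, None, Some F19, None, None]"
| "f_f F15 = [None, None, None, None, None]"
| "f_f F16 = [None, None, None, Some F20, None]"
| "f_f F17 = [None, Some F21, None, None, None]"
| "f_f F18 = [None, None, None, None, Some F22]"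
| "f_f F19 = [None, Some F25, None, Some F24, None]"
| "f_f F20 = [None, None, Some F24, None, Some F26]"
| "f_f F21 = [Some F27, None, Some F25, None, None]"
| "f_f F22 = [None, None, None, Some F26, None]"
| "f_f F23 = [None, Some F27, None, None, None]"
| "f_f F24 = [None, Some F28, None, Some F29, Some F30]"
| "f_f F25 = [Some F31, None, None, Some F28, None]"
| "f_f F26 = [None, None, Some F30, None, None]"
| "f_f F27 = [None, None, Some F31, None, None]"
| "f_f F28 = [Some F34, None, None, Some F32, Some F33]"
| "f_f F29 = [None, Some F32, None, None, Some F35]"
| "f_f F30 = [None, Some F33, None, Some F35, None]"
| "f_f F31 = [None, None, None, Some F34, None]"
| "f_f F32 = [Some F37, None, Some F38, None, Some F36]"
| "f_f F33 = [Some F39, None, None, Some F36, None]"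
| "f_f F34 = [None, None, None, Some F37, Some F39]"
| "f_f F35 = [None, Some F36, None, None, Some F40]"
| "f_f F36 = [Some F41, None, Some F42, None, Some F43]"
| "f_f F37 = [None, None, Some F44, None, Some F41]"
| "f_f F38 = [Some F44, None, None, None, Some F42]"
| "f_f F39 = [None, None, None, Some F41, None]"
| "f_f F40 = [None, Some F43, None, None, None]"
| "f_f F41 = [None, None, Some F0, None, Some F45]"
| "f_f F42 = [Some F0, None, None, Some F46, Some F47]"
| "f_f F43 = [Some F45, None, Some F47, None, None]"
| "f_f F44 = [None, Some F48, None, None, Some F0]"
| "f_f F45 = [None, None, Some F2, None, None]"
| "f_f F46 = [Some F1, None, None, None, Some F49]"
| "f_f F47 = [Some F2, None, None, Some F49, None]"
| "f_f F48 = [None, None, None, None, Some F3]"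
| "f_f F49 = [Some F4, None, None, Some F50, None]"
| "f_f F50 = [Some F8, None, Some F51, None, None]"
| "f_f F51 = [Some F12, Some F52, None, None, None]"
| "f_f F52 = [Some F53, None, None, None, None]"
| "f_f F53 = [Some F23, None, None, None, None]"

primrec f_e :: "f_state \<Rightarrow> f_state option list" where
  "f_e F0 = [Some F42, None, Some F41, None, Some F44]"
| "f_e F1 = [Some F46, None, None, Some F0, None]"
| "f_e F2 = [Some F47, None, Some F45, None, Some F0]"
| "f_e F3 = [None, Some F0, None, None, Some F48]"
| "f_e F4 = [Some F49, None, None, Some F2, Some F1]"
| "f_e F5 = [None, Some F1, None, Some F3, None]"
| "f_e F6 = [None, Some F2, None, None, Some F3]"
| "f_e F7 = [None, Some F4, None, Some F6, Some F5]"
| "f_e F8 = [Some F50, None, None, Some F4, None]"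
| "f_e F9 = [None, None, Some F5, None, None]"
| "f_e F10 = [None, Some F8, None, Some F7, None]"
| "f_e F11 = [None, None, Some F7, None, Some F9]"
| "f_e F12 = [Some F51, None, Some F8, None, None]"
| "f_e F13 = [None, None, None, Some F9, None]"
| "f_e F14 = [None, None, Some F10, None, None]"
| "f_e F15 = [None, None, None, None, None]"
| "f_e F16 = [None, None, None, Some F11, None]"
| "f_e F17 = [None, Some F12, None, None, None]"
| "f_e F18 = [None, None, None, None, Some F13]"
| "f_e F19 = [None, None, Some F14, None, None]"
| "f_e F20 = [None, None, None, Some F16, None]"
| "f_e F21 = [None, Some F17, None, None, None]"
| "f_e F22 = [None, None, None, None, Some F18]"
| "f_e F23 = [Some F53, None, None, None, None]"
| "f_e F24 = [None, None, Some F20, Some F19, None]"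
| "f_e F25 = [None, Some F19, Some F21, None, None]"
| "f_e F26 = [None, None, None, Some F22, Some F20]"
| "f_e F27 = [Some F21, Some F23, None, None, None]"
| "f_e F28 = [None, Some F24, None, Some F25, None]"
| "f_e F29 = [None, None, None, Some F24, None]"
| "f_e F30 = [None, None, Some F26, None, Some F24]"
| "f_e F31 = [Some F25, None, Some F27, None, None]"
| "f_e F32 = [None, Some F29, None, Some F28, None]"
| "f_e F33 = [None, Some F30, None, None, Some F28]"
| "f_e F34 = [Some F28, None, None, Some F31, None]"
| "f_e F35 = [None, None, None, Some F30, Some F29]"
| "f_e F36 = [None, Some F35, None, Some F33, Some F32]"
| "f_e F37 = [Some F32, None, None, Some F34, None]"
| "f_e F38 = [None, None, Some F32, None, None]"
| "f_e F39 = [Some F33, None, None, None, Some F34]"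
| "f_e F40 = [None, None, None, None, Some F35]"
| "f_e F41 = [Some F36, None, None, Some F39, Some F37]"
| "f_e F42 = [None, None, Some F36, None, Some F38]"
| "f_e F43 = [None, Some F40, None, None, Some F36]"
| "f_e F44 = [Some F38, None, Some F37, None, None]"
| "f_e F45 = [Some F43, None, None, None, Some F41]"
| "f_e F46 = [None, None, None, Some F42, None]"
| "f_e F47 = [None, None, Some F43, None, Some F42]"
| "f_e F48 = [None, Some F44, None, None, None]"
| "f_e F49 = [None, None, None, Some F47, Some F46]"
| "f_e F50 = [None, None, None, Some F49, None]"
| "f_e F51 = [None, None, Some F50, None, None]"
| "f_e F52 = [None, Some F51, None, None, None]"
| "f_e F53 = [Some F52, None, None, None, None]"

primrec f_phis :: "f_state \<Rightarrow> nat list" where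
  "f_phis F0 = [0, 1, 0, 1, 1]"
| "f_phis F1 = [0, 1, 0, 0, 1]"
| "f_phis F2 = [0, 1, 0, 2, 0]"
| "f_phis F3 = [0, 0, 0, 1, 1]"
| "f_phis F4 = [0, 1, 0, 1, 0]"
| "f_phis F5 = [0, 0, 1, 0, 1]"
| "f_phis F6 = [0, 0, 0, 2, 0]"
| "f_phis F7 = [0, 0, 1, 1, 0]"
| "f_phis F8 = [0, 1, 1, 0, 0]"
| "f_phis F9 = [0, 0, 0, 1, 1]"
| "f_phis F10 = [0, 0, 2, 0, 0]"
| "f_phis F11 = [0, 0, 0, 2, 0]"
| "f_phis F12 = [0, 2, 0, 0, 0]"
| "f_phis F13 = [0, 0, 0, 0, 2]"
| "f_phis F14 = [0, 0, 1, 0, 0]"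
| "f_phis F15 = [0, 0, 0, 0, 0]"
| "f_phis F16 = [0, 0, 0, 1, 0]"
| "f_phis F17 = [0, 1, 0, 0, 0]"
| "f_phis F18 = [0, 0, 0, 0, 1]"
| "f_phis F19 = [0, 1, 0, 2, 0]"
| "f_phis F20 = [0, 0, 1, 0, 1]"
| "f_phis F21 = [1, 0, 1, 0, 0]"
| "f_phis F22 = [0, 0, 0, 1, 0]"
| "f_phis F23 = [0, 1, 0, 0, 0]"
| "f_phis F24 = [0, 1, 0, 1, 1]"
| "f_phis F25 = [1, 0, 0, 2, 0]"
| "f_phis F26 = [0, 0, 1, 0, 0]"
| "f_phis F27 = [0, 0, 1, 0, 0]"
| "f_phis F28 = [1, 0, 0, 1, 1]"
| "f_phis F29 = [0, 1, 0, 0, 2]"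
| "f_phis F30 = [0, 1, 0, 1, 0]"
| "f_phis F31 = [0, 0, 0, 2, 0]"
| "f_phis F32 = [1, 0, 1, 0, 2]"
| "f_phis F33 = [1, 0, 0, 1, 0]"
| "f_phis F34 = [0, 0, 0, 1, 1]"
| "f_phis F35 = [0, 1, 0, 0, 1]"
| "f_phis F36 = [1, 0, 1, 0, 1]"
| "f_phis F37 = [0, 0, 1, 0, 2]"
| "f_phis F38 = [1, 0, 0, 0, 2]"
| "f_phis F39 = [0, 0, 0, 1, 0]"
| "f_phis F40 = [0, 1, 0, 0, 0]"
| "f_phis F41 = [0, 0, 1, 0, 1]"
| "f_phis F42 = [1, 0, 0, 1, 1]"
| "f_phis F43 = [1, 0, 1, 0, 0]"
| "f_phis F44 = [0, 1, 0, 0, 2]"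
| "f_phis F45 = [0, 0, 1, 0, 0]"
| "f_phis F46 = [1, 0, 0, 0, 1]"
| "f_phis F47 = [1, 0, 0, 2, 0]"
| "f_phis F48 = [0, 0, 0, 0, 2]"
| "f_phis F49 = [1, 0, 0, 1, 0]"
| "f_phis F50 = [1, 0, 1, 0, 0]"
| "f_phis F51 = [1, 1, 0, 0, 0]"
| "f_phis F52 = [2, 0, 0, 0, 0]"
| "f_phis F53 = [1, 0, 0, 0, 0]"

primrec f_epss :: "f_state \<Rightarrow> nat list" where
  "f_epss F0 = [1, 0, 1, 0, 1]"
| "f_epss F1 = [1, 0, 0, 1, 0]"
| "f_epss F2 = [1, 0, 1, 0, 2]"
| "f_epss F3 = [0, 1, 0, 0, 1]"
| "f_epss F4 = [1, 0, 0, 1, 1]"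
| "f_epss F5 = [0, 1, 0, 1, 0]"
| "f_epss F6 = [0, 1, 0, 0, 2]"
| "f_epss F7 = [0, 1, 0, 1, 1]"
| "f_epss F8 = [1, 0, 0, 2, 0]"
| "f_epss F9 = [0, 0, 1, 0, 0]"
| "f_epss F10 = [0, 1, 0, 2, 0]"
| "f_epss F11 = [0, 0, 1, 0, 1]"
| "f_epss F12 = [1, 0, 1, 0, 0]"
| "f_epss F13 = [0, 0, 0, 1, 0]"
| "f_epss F14 = [0, 0, 1, 0, 0]"
| "f_epss F15 = [0, 0, 0, 0, 0]"
| "f_epss F16 = [0, 0, 0, 1, 0]"
| "f_epss F17 = [0, 1, 0, 0, 0]"
| "f_epss F18 = [0, 0, 0, 0, 1]"
| "f_epss F19 = [0, 0, 2, 0, 0]"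
| "f_epss F20 = [0, 0, 0, 2, 0]"
| "f_epss F21 = [0, 2, 0, 0, 0]"
| "f_epss F22 = [0, 0, 0, 0, 2]"
| "f_epss F23 = [2, 0, 0, 0, 0]"
| "f_epss F24 = [0, 0, 1, 1, 0]"
| "f_epss F25 = [0, 1, 1, 0, 0]"
| "f_epss F26 = [0, 0, 0, 1, 1]"
| "f_epss F27 = [1, 1, 0, 0, 0]"
| "f_epss F28 = [0, 1, 0, 1, 0]"
| "f_epss F29 = [0, 0, 0, 2, 0]"
| "f_epss F30 = [0, 0, 1, 0, 1]"
| "f_epss F31 = [1, 0, 1, 0, 0]"
| "f_epss F32 = [0, 1, 0, 2, 0]"
| "f_epss F33 = [0, 1, 0, 0, 1]"
| "f_epss F34 = [1, 0, 0, 1, 0]"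
| "f_epss F35 = [0, 0, 0, 1, 1]"
| "f_epss F36 = [0, 1, 0, 1, 1]"
| "f_epss F37 = [1, 0, 0, 2, 0]"
| "f_epss F38 = [0, 0, 1, 0, 0]"
| "f_epss F39 = [1, 0, 0, 0, 1]"
| "f_epss F40 = [0, 0, 0, 0, 2]"
| "f_epss F41 = [1, 0, 0, 1, 1]"
| "f_epss F42 = [0, 0, 1, 0, 1]"
| "f_epss F43 = [0, 1, 0, 0, 2]"
| "f_epss F44 = [1, 0, 1, 0, 0]"
| "f_epss F45 = [1, 0, 0, 0, 2]"
| "f_epss F46 = [0, 0, 0, 1, 0]"
| "f_epss F47 = [0, 0, 1, 0, 2]"
| "f_epss F48 = [0, 1, 0, 0, 0]"
| "f_epss F49 = [0, 0, 0, 1, 1]"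
| "f_epss F50 = [0, 0, 0, 2, 0]"
| "f_epss F51 = [0, 0, 1, 0, 0]"
| "f_epss F52 = [0, 1, 0, 0, 0]"
| "f_epss F53 = [1, 0, 0, 0, 0]"

definition f_specials :: "(nat \<times> f_state) list" where
  "f_specials = [(1, F17), (2, F14), (3, F16), (4, F18)]"

section \<open>Verification of the tables by evaluation\<close>

lemma set_f_states: "set f_states = UNIV"
proof -
  have "s \<in> set f_states" for s
    by (cases s) (simp_all add: f_states_def)
  then show ?thesis
    by blast
qed

lemma f_rows_distinct: "distinct (map f_rows f_states)"
  by code_simp

lemma f_rows_check: "\<forall>s\<in>set f_states.
      filter (\<lambda>l. l \<in> set (fst (f_rows s))) f_letters = fst (f_rows s) \<and>
      filter (\<lambda>l. l \<in> set (snd (f_rows s))) f_letters = snd (f_rows s) \<and>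
      (\<exists>l\<in>set f_letters. l \<notin> set (fst (f_rows s)))"
  by code_simp

lemma f_empty_check: "\<exists>s\<in>set f_states. f_rows s = ([], [])"
  by code_simp

lemma f_pre_young_check: "\<forall>s\<in>set f_states.
      (\<forall>l\<in>set (fst (f_rows s)). \<forall>c\<in>f_rests_on (l, 0). in_window (f_rows s) c) \<and>
      (\<forall>l\<in>set (snd (f_rows s)). \<forall>c\<in>f_rests_on (l, 1). in_window (f_rows s) c)"
  by code_simp

lemma f_up_complete_check: "\<forall>s\<in>set f_states. \<forall>m\<in>set [0, 1, 2]. \<forall>l\<in>set f_letters.
      in_window (f_rows s) (l, m) \<or> (\<exists>c\<in>f_rests_on (l, m). \<not> in_window (f_rows s) c) \<or>
      (l, m) \<in> set (map fst (f_up s))"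
  by code_simp

lemma f_up_sound_check: "\<forall>s\<in>set f_states. \<forall>(b, t, n)\<in>set (f_up s).
      0 \<le> n \<and> n \<le> 1 \<and> 0 \<le> snd b \<and> snd b \<le> 2 \<and> \<not> in_window (f_rows s) b \<and>
      (\<forall>m\<in>set [0, 1, 2]. \<forall>l\<in>set f_letters.
        (l, m) = b \<or> in_window (f_rows s) (l, m) \<longleftrightarrow> in_window (f_rows t) (l, m - n))"
  by code_simp

lemma f_up_down_check: "\<forall>s\<in>set f_states. \<forall>(b, t, n)\<in>set (f_up s).
      ((fst b, snd b - n), s, - n) \<in> set (f_down t)"
  by code_simp

lemma f_down_up_check: "\<forall>s\<in>set f_states. \<forall>(b, t, n)\<in>set (f_down s).
      ((fst b, snd b - n), s, - n) \<in> set (f_up t)"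
  by code_simp

lemma f_exc_check: "\<forall>s\<in>set f_states.
      (\<exists>(b, _)\<in>set (f_down s). f_colour (fst b) = 1) \<and>
      length (filter (\<lambda>(b, _). f_colour (fst b) = 2 \<and> -1 \<le> 4 * snd b + f_level (fst b) \<and>
        (\<forall>l\<in>set (fst (f_rows s)). f_level l \<le> 4 * snd b + f_level (fst b)) \<and>
        (\<forall>l\<in>set (snd (f_rows s)). f_level l + 4 \<le> 4 * snd b + f_level (fst b)))
        (f_down s)) = 1 \<longleftrightarrow>
      s = F15"
  by code_simp

lemma f_down_distinct_check: "\<forall>s\<in>set f_states. distinct (map fst (f_down s))"
  by code_simp

lemma f_table_check: "\<forall>s\<in>set f_states.
      length (f_e s) = 5 \<and> length (f_phis s) = 5 \<and> length (f_epss s) = 5 \<and>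
      (s \<noteq> F15 \<longrightarrow> (\<forall>i\<in>colours.
        arrow_ok (<) (\<lambda>b. f_colour (fst b)) (\<lambda>b. 4 * snd b + f_level (fst b))
          f_specials F15 i s (f_up s) (f_f s ! i) \<and>
        arrow_ok (>) (\<lambda>b. f_colour (fst b)) (\<lambda>b. 4 * snd b + f_level (fst b))
          f_specials F15 i s (f_down s) (f_e s ! i) \<and>
        (case f_e s ! i of None \<Rightarrow> f_epss s ! i = 0
          | Some t \<Rightarrow> f_epss s ! i = Suc (f_epss t ! i) \<and> f_f t ! i = Some s) \<and>
        (case f_f s ! i of None \<Rightarrow> f_phis s ! i = 0
          | Some t \<Rightarrow> f_phis s ! i = Suc (f_phis t ! i))))"
  by code_simp

text \<open>\<open>Fz\<close> and \<open>Fb3\<close> rest on blocks of their own row, so the level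
  does not decrease there. Lifting both to 4 restores strictness and keeps them below the next
  index, which starts at 5.\<close>

definition f_height :: "f_letter \<Rightarrow> int" where
  "f_height l = (if l \<in> {Fz, Fb3} then 4 else f_level l)"

text \<open>The block \<open>Fc4\<close> now plays the central role: every block of index k leads
  down to it at index k - 1. There it forces all three letters of level 0, and these force
  everything of index k - 2.\<close>

lemma f_full_below:
  assumes y: "pre_young_column pattern_F4_1 y" and "(l, m) \<in> y" "m' \<le> m - 2"
  shows "(l', m') \<in> y"
proof -
  have rests: "f_rests_on b \<subseteq> y" if "b \<in> y" for b
    using y that by (simp add: pre_young_column_def f_pattern_simps)
  have down: "(Fc1, k) \<in> y \<Longrightarrow> (Fb3, k - 1) \<in> y \<and> (Fc4, k - 1) \<in> y \<and> (Fd2, k - 1) \<in> y"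
    "(Fd1, k) \<in> y \<Longrightarrow> (Fc4, k - 1) \<in> y \<and> (Fd2, k - 1) \<in> y"
    "(Fa1, k) \<in> y \<Longrightarrow> (Fz, k - 1) \<in> y \<and> (Fb3, k - 1) \<in> y"
    "(Fc2, k) \<in> y \<Longrightarrow> (Fc1, k) \<in> y \<and> (Fd1, k) \<in> y"
    "(Fb1, k) \<in> y \<Longrightarrow> (Fc1, k) \<in> y \<and> (Fa1, k) \<in> y"
    "(Fb2, k) \<in> y \<Longrightarrow> (Fc2, k) \<in> y"
    "(Fc3, k) \<in> y \<Longrightarrow> (Fb1, k) \<in> y"
    "(Fa2, k) \<in> y \<Longrightarrow> (Fb2, k) \<in> y"
    "(Fc4, k) \<in> y \<Longrightarrow> (Fb2, k) \<in> y \<and> (Fc3, k) \<in> y"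
    "(Fd2, k) \<in> y \<Longrightarrow> (Fc3, k) \<in> y"
    "(Fz, k) \<in> y \<Longrightarrow> (Fa2, k) \<in> y"
    "(Fb3, k) \<in> y \<Longrightarrow> (Fa2, k) \<in> y \<and> (Fc4, k) \<in> y" for k
    using rests[of "(Fc1, k)"]
      rests[of "(Fd1, k)"]
      rests[of "(Fa1, k)"]
      rests[of "(Fc2, k)"]
      rests[of "(Fb1, k)"]
      rests[of "(Fb2, k)"]
      rests[of "(Fc3, k)"]
      rests[of "(Fa2, k)"]
      rests[of "(Fc4, k)"]
      rests[of "(Fd2, k)"]
      rests[of "(Fz, k)"]
      rests[of "(Fb3, k)"]
    by simp_all
  have hub: "(Fc4, k - 1) \<in> y" if "(l, k) \<in> y" for l k
    using that down[of k] down[of "k - 1"] by (cases l) simp_all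
  have below: "(Fc1, k) \<in> y \<and> (Fd1, k) \<in> y \<and> (Fa1, k) \<in> y" if "(Fc4, k) \<in> y" for k
    using that down[of k] by simp
  have all: "(l, k - 1) \<in> y" if "(Fc1, k) \<in> y \<and> (Fd1, k) \<in> y \<and> (Fa1, k) \<in> y" for l k
    using that down[of k] down[of "k - 1"] by (cases l) simp_all
  have "\<forall>l'. (l', m') \<in> y"
    using assms(3)
  proof (induction m' rule: int_le_induct)
    case base
    show ?case
      using all[OF below[OF hub[OF assms(2)]]] by simp
  next
    case (step k)
    then show ?case
      using all by blast
  qed
  then show ?thesis
    by blast
qed

lemma f_periodic: "periodic_pattern pattern_F4_1 f_height Fz"
proof (unfold_locales, unfold f_pattern_simps)
  show "finite (UNIV :: f_letter set)"
    using finite_set[of f_letters] by (simp add: set_f_letters)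
  show "0 \<le> f_level l" "f_level l \<le> 3" for l
    by (cases l; simp)+
  show "\<exists>l. f_level l = 3"
    by (rule exI[of _ Fz]) simp
  show "f_colour l = 0 \<longleftrightarrow> l = Fz" for l
    by (cases l) simp_all
  show "f_rests_on (l, m + n) = shift n (f_rests_on (l, m))" for l m n
    by (cases l) (auto simp: shift_def)
  show "f_rests_on b \<noteq> {}" for b
    by (cases b rule: f_rests_on.cases) auto
  show "snd c = snd b \<or> snd c = snd b - 1" if "c \<in> f_rests_on b" for b c
    using that by (cases b rule: f_rests_on.cases) auto
  show "5 * snd c + f_height (fst c) < 5 * snd b + f_height (fst b)" if "c \<in> f_rests_on b" for b c
    using that by (cases b rule: f_rests_on.cases) (auto simp: f_height_def)
qed (rule f_full_below)

lemma f_vacuum: "vacuum pattern_F4_1 = window (f_rows F53)"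
proof (intro set_eqI, unfold split_paired_all)
  show "(l, m) \<in> vacuum pattern_F4_1 \<longleftrightarrow> (l, m) \<in> window (f_rows F53)" for l m
    by (cases l) (auto simp: pattern_F4_1_def f_base_def)
qed

lemma f_special_1:
  "f_base \<union> {(Fz, 0), (Fd2, 0), (Fc1, 1), (Fd1, 1), (Fc2, 1), (Fb2, 1), (Fa2, 1)} =
    shift 1 (window (f_rows F17))" (is "?x = ?y")
proof (intro set_eqI, unfold split_paired_all)
  show "(l, m) \<in> ?x \<longleftrightarrow> (l, m) \<in> ?y" for l m
    by (cases l) (auto simp: f_base_def)
qed

lemma f_special_2:
  "f_base \<union> {(Fz, 0), (Fa1, 1), (Fb1, 1), (Fd2, 0), (Fc1, 1), (Fd1, 1), (Fc2, 1)} =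
    shift 1 (window (f_rows F14))" (is "?x = ?y")
proof (intro set_eqI, unfold split_paired_all)
  show "(l, m) \<in> ?x \<longleftrightarrow> (l, m) \<in> ?y" for l m
    by (cases l) (auto simp: f_base_def)
qed

lemma f_special_3:
  "f_base \<union> {(Fz, 0), (Fa1, 1), (Fb1, 1), (Fc3, 1), (Fd2, 0), (Fc1, 1), (Fd1, 1)} =
    shift 1 (window (f_rows F16))" (is "?x = ?y")
proof (intro set_eqI, unfold split_paired_all)
  show "(l, m) \<in> ?x \<longleftrightarrow> (l, m) \<in> ?y" for l m
    by (cases l) (auto simp: f_base_def)
qed

lemma f_special_4:
  "f_base \<union> {(Fz, 0), (Fa1, 1), (Fb1, 1), (Fc3, 1), (Fd2, 1), (Fd2, 0), (Fc1, 1)} =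
    shift 1 (window (f_rows F18))" (is "?x = ?y")
proof (intro set_eqI, unfold split_paired_all)
  show "(l, m) \<in> ?x \<longleftrightarrow> (l, m) \<in> ?y" for l m
    by (cases l) (auto simp: f_base_def)
qed

lemma f_special:
  "special pattern_F4_1 j =
    map_option (\<lambda>t. shift 1 (window (f_rows t))) (map_of f_specials j)"
  unfolding pattern_F4_1_def f_specials_def f_special_1 f_special_2 f_special_3 f_special_4 by simp

lemma f_special_Some:
  assumes "special pattern_F4_1 j = Some c"
  shows "\<exists>t k. (j, t) \<in> set f_specials \<and> c = shift k (window (f_rows t))"
  using assms unfolding f_special by (auto dest: map_of_SomeD)

lemma f_specials:
  assumes "(j, t) \<in> set f_specials"
  shows "t \<noteq> F15 \<and> (\<exists>k. special pattern_F4_1 j = Some (shift k (window (f_rows t))))"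
  using assms unfolding f_special by (auto simp: f_specials_def)

section \<open>Energies and inclusions in type F_4^(1)\<close>

interpretation F4: column_automaton pattern_F4_1 f_height Fz f_letters f_states f_rows f_up
  f_down F15 F53 f_specials f_f f_e f_phis f_epss
proof (intro column_automaton.intro column_automaton_axioms.intro f_periodic,
    unfold f_pattern_simps)
  show "F53 \<noteq> F15"
    by simp
qed (fact set_f_letters set_f_states f_rows_distinct f_rows_check f_empty_check
  f_pre_young_check f_up_complete_check f_up_sound_check f_up_down_check
  f_down_up_check f_exc_check f_down_distinct_check f_vacuum f_special_Some
  f_specials f_table_check)+

text \<open>The stuck pairs follow the same pattern: the first factor is \<open>F23\<close> or the
  vacuum state \<open>F53\<close>. With \<open>F53\<close> the second factor has no raising in
  colours 1 to 4; with \<open>F23\<close> it may have \<open>eps\<close> at most 1 in colour 1 and 0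
  in colours 2 to 4.\<close>

definition f_known :: "((f_state \<times> f_state) \<times> int) list" where
  "f_known = [
     ((F23, F17), 0), ((F23, F23), 2), ((F23, F27), 1), ((F23, F48), 0),
     ((F23, F52), 0), ((F23, F53), 1), ((F53, F23), 1), ((F53, F53), 0)]"

definition f_known_energy :: "f_state \<times> f_state \<Rightarrow> int option" where
  "f_known_energy p = map_of f_known p"

definition f_vacuum_energy :: "f_state \<times> f_state \<Rightarrow> int option" where
  "f_vacuum_energy p = [(F53, F53) \<mapsto> 0] p"

lemma f_known_check: "\<forall>((a, b), h)\<in>set f_known. a \<noteq> F15 \<and> b \<noteq> F15 \<and>
    climb (raise f_e f_phis f_epss) (raise_zero f_e f_phis f_epss) f_vacuum_energy (a, b) = Some h"
  by code_simp

lemma f_included_check: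
  "list_all (row_included
    (climb (raise f_e f_phis f_epss) (raise_zero f_e f_phis f_epss) f_known_energy)
    f_rows Fz F15 f_states) f_states"
  by code_simp

theorem f_local_right_block:
  assumes "energy_function pattern_F4_1 H" "g \<in> vacuum_class pattern_F4_1"
    and "Y \<in> proper_young_walls pattern_F4_1 H g"
    and "H (column_class pattern_F4_1 (Y (k + 1)), column_class pattern_F4_1 (Y k))
      + zero_count pattern_F4_1 g (Y (k + 1)) - zero_count pattern_F4_1 g (Y k) \<noteq> -1"
  shows "local_right_block Y k"
proof (rule F4.local_right_block_property[OF _ f_included_check assms])
  fix a b h
  assume "f_known_energy (a, b) = Some h"
  then have "((a, b), h) \<in> set f_known"
    unfolding f_known_energy_def by (rule map_of_SomeD)
  moreover have "f_vacuum_energy = [(F53, F53) \<mapsto> 0]"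
    by (rule ext) (simp add: f_vacuum_energy_def)
  ultimately show "a \<noteq> F15 \<and> b \<noteq> F15 \<and>
      climb (raise f_e f_phis f_epss) (raise_zero f_e f_phis f_epss) [(F53, F53) \<mapsto> 0] (a, b) = Some h"
    using f_known_check by auto
qed

theorem proposition5p4:
  shows "(\<forall>H g Y k.
            energy_function pattern_E6_2 H \<longrightarrow>
            g \<in> vacuum_class pattern_E6_2 \<longrightarrow>
            Y \<in> proper_young_walls pattern_E6_2 H g \<longrightarrow>
            H (column_class pattern_E6_2 (Y (k + 1)), column_class pattern_E6_2 (Y k))
              + zero_count pattern_E6_2 g (Y (k + 1)) - zero_count pattern_E6_2 g (Y k) \<noteq> -1 \<longrightarrow>
            local_right_block Y k)
       \<and> (\<forall>H' g Y k.
            energy_function pattern_F4_1 H' \<longrightarrow>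
            g \<in> vacuum_class pattern_F4_1 \<longrightarrow>
            Y \<in> proper_young_walls pattern_F4_1 H' g \<longrightarrow>
            H' (column_class pattern_F4_1 (Y (k + 1)), column_class pattern_F4_1 (Y k))
              + zero_count pattern_F4_1 g (Y (k + 1)) - zero_count pattern_F4_1 g (Y k) \<noteq> -1 \<longrightarrow>
            local_right_block Y k)"
  using e_local_right_block f_local_right_block by blast

end
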